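(* Let $G$ be a group and let $\pi\colon G\to U_k(\mathbb{C})$ be a faithful unitary representation of $G$ of degree $k$. Let $(\Gamma,\Psi)$ be a $G$-gain graph and denote by $A^+$ the adjacency matrix of its underlying graph $\Gamma$. The following are equivalent: (i) $(\Gamma,\Psi)$ is balanced; (ii) the spectrum $\sigma(A_\pi)$ consists of $k$ copies of the spectrum $\sigma(A^+)$. Moreover, if $G$ is finite and $\Gamma$ is connected, the following are also equivalent to (i) and (ii): (iii) the spectral radius $\rho(\Gamma)$ occurs in $\sigma(A_\pi)$ with multiplicity $k$; (iv) as $h\to\infty$, if $\Gamma$ is not bipartite then $\dfrac{Tr(A_\pi^{h})}{Tr(|A|_\pi^{h})}\to 1$, and if $\Gamma$ is bipartite then $\dfrac{Tr(A_\pi^{2h})}{Tr(|A|_\pi^{2h})}\to 1$.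
   Context: $G$ is an arbitrary (finite or infinite) group with identity $1_G$. $U_k(\mathbb{C})$ is the group of $k\times k$ unitary matrices; a unitary representation of degree $k$ is a group homomorphism $\pi\colon G\to U_k(\mathbb{C})$, and it is faithful if $\ker(\pi)=\{1_G\}$. $\Gamma=(V_\Gamma,E_\Gamma)$ is a finite simple graph (no loops, no multiple edges) whose edges are regarded as ordered pairs, with $(v,u)\in E_\Gamma$ if and only if $(u,v)\in E_\Gamma$; write $u\sim v$ if $(u,v)\in E_\Gamma$. A $G$-gain function is a map $\Psi\colon E_\Gamma\to G$ with $\Psi(u,v)=\Psi(v,u)^{-1}$; the pair $(\Gamma,\Psi)$ is a $G$-gain graph. Fix an order $v_1,\dots,v_n$ of $V_\Gamma$. A walk is a sequence of vertices $w_0,\dots,w_h$ with $w_i\sim w_{i+1}$; its gain is $\Psi(w_0,w_1)\cdots\Psi(w_{h-1},w_h)$; it is closed if $w_0=w_h$. $(\Gamma,\Psi)$ is balanced if every closed walk has gain $1_G$. $A^+\in M_n(\mathbb{C})$ is the usual $0/1$ adjacency matrix of $\Gamma$, and $\rho(\Gamma)=\max\{|\mu|:\mu\in\sigma(A^+)\}$. The represented adjacency matrix $A_\pi\in M_{nk}(\mathbb{C})$ of $(\Gamma,\Psi)$ is the $n\times n$ block matrix with $k\times k$ blocks whose $(i,j)$ block is $\pi(\Psi(v_i,v_j))$ if $(v_i,v_j)\in E_\Gamma$ and the zero block otherwise. $|A|_\pi$ is the matrix obtained in the same way from the trivial gain function (constantly $1_G$), i.e. $|A|_\pi=A^+\otimes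 I_k$. $\sigma(\cdot)$ denotes the spectrum of a complex matrix, with eigenvalues counted with multiplicity (a multiset), and $Tr$ is the usual trace of complex matrices. In (iv) the quotients are considered only for those $h$ for which the denominator is nonzero: convergence to $1$ means that for every $\varepsilon>0$ there is $N$ such that the quotient is within $\varepsilon$ of $1$ for all $h\ge N$ with nonzero denominator. *)

theory Defs
  imports
    "HOL-Algebra.Coset"
    "Jordan_Normal_Form.Schur_Decomposition"
    "Jordan_Normal_Form.Spectral_Radius"
    "Graph_Theory.Graph_Theory"
begin

section \<open>Unitary representations\<close>

definition unitary_mat :: "complex mat \<Rightarrow> bool" where
  "unitary_mat U \<longleftrightarrow>
     mat_adjoint U * U = 1\<^sub>m (dim_col U) \<and> U * mat_adjoint U = 1\<^sub>m (dim_row U)"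

definition unitary_group :: "nat \<Rightarrow> complex mat monoid" where
  "unitary_group k =
     \<lparr>carrier = {U \<in> carrier_mat k k. unitary_mat U}, mult = (*), one = 1\<^sub>m k\<rparr>"

definition unitary_representation ::
    "('g, 'm) monoid_scheme \<Rightarrow> nat \<Rightarrow> ('g \<Rightarrow> complex mat) \<Rightarrow> bool" where
  "unitary_representation G k \<pi> \<longleftrightarrow> \<pi> \<in> hom G (unitary_group k)"

definition faithful_representation ::
    "('g, 'm) monoid_scheme \<Rightarrow> nat \<Rightarrow> ('g \<Rightarrow> complex mat) \<Rightarrow> bool" where
  "faithful_representation G k \<pi> \<longleftrightarrow> kernel G (unitary_group k) \<pi> = {\<one>\<^bsub>G\<^esub>}"

lemma mat_adjoint_carrier: "A \<in> carrier_mat n m \<Longrightarrow> mat_adjoint A \<in> carrier_mat m n"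
  by (auto simp: mat_adjoint_def mat_of_rows_def)

lemma mat_adjoint_index:
  "i < dim_col A \<Longrightarrow> j < dim_row A \<Longrightarrow> mat_adjoint A $$ (i, j) = conjugate (A $$ (j, i))"
  by (simp add: mat_adjoint_def mat_of_rows_def)

lemma mat_adjoint_mult:
  fixes A B :: "complex mat"
  assumes A: "A \<in> carrier_mat n n" and B: "B \<in> carrier_mat n n"
  shows "mat_adjoint (A * B) = mat_adjoint B * mat_adjoint A"
proof (rule eq_matI)
  note c = mat_adjoint_carrier[OF A] mat_adjoint_carrier[OF B]
  fix i j
  assume "i < dim_row (mat_adjoint B * mat_adjoint A)"
    and "j < dim_col (mat_adjoint B * mat_adjoint A)"
  then have ij: "i < n" "j < n" using c by auto
  have "mat_adjoint (A * B) $$ (i, j) = conjugate (\<Sum>l = 0..<n. A $$ (j, l) * B $$ (l, i))"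
    using A B ij by (simp add: mat_adjoint_index scalar_prod_def)
  also have "\<dots> = (\<Sum>l = 0..<n. mat_adjoint B $$ (i, l) * mat_adjoint A $$ (l, j))"
    using A B ij by (simp add: mat_adjoint_index mult.commute)
  also have "\<dots> = (mat_adjoint B * mat_adjoint A) $$ (i, j)"
    using c ij by (simp add: scalar_prod_def)
  finally show "mat_adjoint (A * B) $$ (i, j) = (mat_adjoint B * mat_adjoint A) $$ (i, j)" .
qed (use A B mat_adjoint_carrier[OF A] mat_adjoint_carrier[OF B]
       mat_adjoint_carrier[OF mult_carrier_mat[OF A B]] in auto)

lemma mat_adjoint_adjoint: "mat_adjoint (mat_adjoint (A :: complex mat)) = A"
proof (rule eq_matI)
  have c: "mat_adjoint A \<in> carrier_mat (dim_col A) (dim_row A)"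
    by (rule mat_adjoint_carrier) auto
  have cc: "mat_adjoint (mat_adjoint A) \<in> carrier_mat (dim_row A) (dim_col A)"
    by (rule mat_adjoint_carrier[OF c])
  show "dim_row (mat_adjoint (mat_adjoint A)) = dim_row A"
    "dim_col (mat_adjoint (mat_adjoint A)) = dim_col A" using cc by auto
  fix i j assume "i < dim_row A" "j < dim_col A"
  then show "mat_adjoint (mat_adjoint A) $$ (i, j) = A $$ (i, j)"
    using c by (simp add: mat_adjoint_index)
qed

lemma mat_adjoint_one: "mat_adjoint (1\<^sub>m n :: complex mat) = 1\<^sub>m n"
proof (rule eq_matI)
  have c: "mat_adjoint (1\<^sub>m n :: complex mat) \<in> carrier_mat n n"
    by (rule mat_adjoint_carrier) auto
  show "dim_row (mat_adjoint (1\<^sub>m n :: complex mat)) = dim_row (1\<^sub>m n :: complex mat)"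
    "dim_col (mat_adjoint (1\<^sub>m n :: complex mat)) = dim_col (1\<^sub>m n :: complex mat)"
    using c by auto
  fix i j assume "i < dim_row (1\<^sub>m n :: complex mat)" "j < dim_col (1\<^sub>m n :: complex mat)"
  then show "mat_adjoint (1\<^sub>m n :: complex mat) $$ (i, j) = 1\<^sub>m n $$ (i, j)"
    by (auto simp: mat_adjoint_index)
qed

lemma group_unitary_group: "group (unitary_group k)"
proof (rule groupI)
  fix A B assume "A \<in> carrier (unitary_group k)" "B \<in> carrier (unitary_group k)"
  then have A: "A \<in> carrier_mat k k" "mat_adjoint A * A = 1\<^sub>m k" "A * mat_adjoint A = 1\<^sub>m k"
    and B: "B \<in> carrier_mat k k" "mat_adjoint B * B = 1\<^sub>m k" "B * mat_adjoint B = 1\<^sub>m k"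
    by (auto simp: unitary_group_def unitary_mat_def)
  note cA = mat_adjoint_carrier[OF A(1)] and cB = mat_adjoint_carrier[OF B(1)]
  have "mat_adjoint (A * B) * (A * B) = mat_adjoint B * (mat_adjoint A * (A * B))"
    unfolding mat_adjoint_mult[OF A(1) B(1)]
    by (rule assoc_mult_mat[OF cB cA mult_carrier_mat[OF A(1) B(1)]])
  also have "mat_adjoint A * (A * B) = B"
    using assoc_mult_mat[OF cA A(1) B(1)] A(2) left_mult_one_mat[OF B(1)] by simp
  finally have 1: "mat_adjoint (A * B) * (A * B) = 1\<^sub>m k" by (simp only: B(2))
  have "A * B * mat_adjoint (A * B) = A * (B * (mat_adjoint B * mat_adjoint A))"
    unfolding mat_adjoint_mult[OF A(1) B(1)]
    by (rule assoc_mult_mat[OF A(1) B(1) mult_carrier_mat[OF cB cA]])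
  also have "B * (mat_adjoint B * mat_adjoint A) = mat_adjoint A"
    using assoc_mult_mat[OF B(1) cB cA] B(3) left_mult_one_mat[OF cA] by simp
  finally have 2: "A * B * mat_adjoint (A * B) = 1\<^sub>m k" by (simp only: A(3))
  show "A \<otimes>\<^bsub>unitary_group k\<^esub> B \<in> carrier (unitary_group k)"
    using 1 2 mult_carrier_mat[OF A(1) B(1)] carrier_matD[OF A(1)] carrier_matD[OF B(1)]
    by (simp add: unitary_group_def unitary_mat_def)
next
  fix A assume "A \<in> carrier (unitary_group k)"
  then have A: "A \<in> carrier_mat k k" "mat_adjoint A * A = 1\<^sub>m k" "A * mat_adjoint A = 1\<^sub>m k"
    by (auto simp: unitary_group_def unitary_mat_def)
  show "\<exists>B \<in> carrier (unitary_group k). B \<otimes>\<^bsub>unitary_group k\<^esub> A = \<one>\<^bsub>unitary_group k\<^esub>"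
    using A mat_adjoint_carrier[OF A(1)]
    by (intro bexI[of _ "mat_adjoint A"])
       (auto simp: unitary_group_def unitary_mat_def mat_adjoint_adjoint)
qed (auto simp: unitary_group_def unitary_mat_def mat_adjoint_one)

section \<open>Gain graphs\<close>

text \<open>A finite simple graph whose edges are ordered pairs, closed under reversal,
  is a \<^locale>\<open>pair_graph\<close>.\<close>

definition gain_function ::
    "('g, 'm) monoid_scheme \<Rightarrow> 'v pair_pre_digraph \<Rightarrow> ('v \<times> 'v \<Rightarrow> 'g) \<Rightarrow> bool" where
  "gain_function G \<Gamma> \<Psi> \<longleftrightarrow>
     (\<forall>(u, v) \<in> parcs \<Gamma>. \<Psi> (u, v) \<in> carrier G \<and> \<Psi> (u, v) = inv\<^bsub>G\<^esub> \<Psi> (v, u))"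

definition walk_gain :: "('g, 'm) monoid_scheme \<Rightarrow> ('v \<times> 'v \<Rightarrow> 'g) \<Rightarrow> 'v vwalk \<Rightarrow> 'g" where
  "walk_gain G \<Psi> w = foldr (\<lambda>e x. \<Psi> e \<otimes>\<^bsub>G\<^esub> x) (vwalk_arcs w) \<one>\<^bsub>G\<^esub>"

definition balanced ::
    "('g, 'm) monoid_scheme \<Rightarrow> 'v pair_pre_digraph \<Rightarrow> ('v \<times> 'v \<Rightarrow> 'g) \<Rightarrow> bool" where
  "balanced G \<Gamma> \<Psi> \<longleftrightarrow>
     (\<forall>w. vwalk w (with_proj \<Gamma>) \<and> hd w = last w \<longrightarrow> walk_gain G \<Psi> w = \<one>\<^bsub>G\<^esub>)"

definition bipartite :: "'v pair_pre_digraph \<Rightarrow> bool" where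
  "bipartite \<Gamma> \<longleftrightarrow> (\<exists>X Y. pverts \<Gamma> = X \<union> Y \<and> X \<inter> Y = {} \<and>
     (\<forall>(u, v) \<in> parcs \<Gamma>. (u \<in> X \<and> v \<in> Y) \<or> (u \<in> Y \<and> v \<in> X)))"

section \<open>Matrices of a gain graph\<close>

text \<open>The list \<open>vs\<close> enumerates the vertices and fixes the order of the (block) rows and columns.\<close>

definition adjacency_mat :: "'v pair_pre_digraph \<Rightarrow> 'v list \<Rightarrow> complex mat" where
  "adjacency_mat \<Gamma> vs =
     mat (length vs) (length vs) (\<lambda>(i, j). if (vs ! i, vs ! j) \<in> parcs \<Gamma> then 1 else 0)"

text \<open>Entry \<open>(r, s)\<close> lies in block \<open>(r div k, s div k)\<close>, at position \<open>(r mod k, s mod k)\<close>.\<close>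

definition rep_adjacency_mat ::
    "nat \<Rightarrow> ('g \<Rightarrow> complex mat) \<Rightarrow> 'v pair_pre_digraph \<Rightarrow> ('v \<times> 'v \<Rightarrow> 'g) \<Rightarrow> 'v list \<Rightarrow> complex mat"
  where
  "rep_adjacency_mat k \<pi> \<Gamma> \<Psi> vs =
     mat (length vs * k) (length vs * k) (\<lambda>(r, s).
       let e = (vs ! (r div k), vs ! (s div k))
       in if e \<in> parcs \<Gamma> then \<pi> (\<Psi> e) $$ (r mod k, s mod k) else 0)"

definition abs_rep_adjacency_mat ::
    "('g, 'm) monoid_scheme \<Rightarrow> nat \<Rightarrow> ('g \<Rightarrow> complex mat) \<Rightarrow> 'v pair_pre_digraph \<Rightarrow> 'v list \<Rightarrow> complex mat"
  where
  "abs_rep_adjacency_mat G k \<pi> \<Gamma> vs = rep_adjacency_mat k \<pi> \<Gamma> (\<lambda>_. \<one>\<^bsub>G\<^esub>) vs"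

text \<open>Unlike the set \<^const>\<open>spectrum\<close>, this counts eigenvalues with algebraic multiplicity.\<close>

definition mspectrum :: "complex mat \<Rightarrow> complex multiset" where
  "mspectrum A = proots (char_poly A)"

definition mat_trace :: "complex mat \<Rightarrow> complex" where
  "mat_trace A = (\<Sum>i<dim_row A. A $$ (i, i))"

text \<open>Convergence of the quotients \<open>f h / g h\<close> to 1 along the indices with \<open>g h \<noteq> 0\<close>;
  it holds vacuously if \<open>g\<close> is eventually zero.\<close>

definition quotient_tendsto_one :: "(nat \<Rightarrow> complex) \<Rightarrow> (nat \<Rightarrow> complex) \<Rightarrow> bool" where
  "quotient_tendsto_one f g \<longleftrightarrow>
     (\<forall>\<epsilon>>0. \<exists>N. \<forall>h\<ge>N. g h \<noteq> 0 \<longrightarrow> cmod (f h / g h - 1) < \<epsilon>)"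

end

theory Submission
  imports Defs "HOL-Analysis.Convex"
begin

text \<open>The trace of \<open>A\<^sub>\<pi>\<^sup>h\<close> is the sum of \<open>tr (\<pi> g)\<close> over the gains \<open>g\<close> of the closed walks of length
  \<open>h\<close>, and \<open>Re (tr U) \<le> k\<close> for unitary \<open>U\<close>, with equality only at the identity. So balance says
  exactly that \<open>tr A\<^sub>\<pi>\<^sup>h\<close> is \<open>k\<close> times the number \<open>N h\<close> of closed walks for all \<open>h\<close>, which is (ii) because
  power sums determine a finite multiset.

  If \<open>\<rho>\<close> bounds the moduli of the eigenvalues of a matrix, then the Cesaro means of \<open>\<rho>\<^sup>-\<^sup>h\<close> times
  the traces of its powers converge to the multiplicity of \<open>\<rho>\<close>. For connected \<open>\<Gamma>\<close> the number \<open>\<rho>(\<Gamma>)\<close> is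
  a simple eigenvalue of \<open>A\<^sup>+\<close> (Perron--Frobenius), so the means of the defect \<open>k N h - Re (tr A\<^sub>\<pi>\<^sup>h)\<close> converge to
  \<open>k - m\<close>, where \<open>m\<close> is the multiplicity of \<open>\<rho>(\<Gamma>)\<close> in the spectrum of \<open>A\<^sub>\<pi>\<close>. If some closed walk has
  nontrivial gain, then closed walks with nontrivial gain have positive density among all
  closed walks; as \<open>G\<close> is finite, each contributes at least a fixed amount to the defect, hence
  \<open>m < k\<close>. Condition (iv) forces the defect to be \<open>o(N h)\<close>, hence \<open>m = k\<close>.\<close>

section \<open>Traces of powers and the spectrum\<close>

lemma pow_mat_Suc_left:
  assumes A: "A \<in> carrier_mat n n"
  shows "A ^\<^sub>m Suc h = A * A ^\<^sub>m h"
proof (induction h)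
  case 0
  then show ?case using A by simp
next
  case (Suc h)
  have "A ^\<^sub>m Suc (Suc h) = A * A ^\<^sub>m h * A" using Suc by simp
  also have "\<dots> = A * (A ^\<^sub>m h * A)"
    by (rule assoc_mult_mat[OF A pow_carrier_mat[OF A] A])
  finally show ?case by simp
qed

lemma pow_mat_add:
  assumes A: "A \<in> carrier_mat n n"
  shows "A ^\<^sub>m (h + l) = A ^\<^sub>m h * A ^\<^sub>m l"
proof (induction l)
  case (Suc l)
  then show ?case
    using assoc_mult_mat[OF pow_carrier_mat[OF A, of h] pow_carrier_mat[OF A, of l] A] by simp
qed (use A in simp)

lemma mat_trace_mult_commute:
  assumes A: "A \<in> carrier_mat n m" and B: "B \<in> carrier_mat m n"
  shows "mat_trace (A * B) = mat_trace (B * A)"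
proof -
  have "mat_trace (A * B) = (\<Sum>i<n. \<Sum>j<m. A $$ (i, j) * B $$ (j, i))"
    using A B by (simp add: mat_trace_def scalar_prod_def atLeast0LessThan)
  also have "\<dots> = (\<Sum>j<m. \<Sum>i<n. B $$ (j, i) * A $$ (i, j))"
    by (subst sum.swap) (simp add: mult.commute)
  also have "\<dots> = mat_trace (B * A)"
    using A B by (simp add: mat_trace_def scalar_prod_def atLeast0LessThan)
  finally show ?thesis .
qed

lemma mat_trace_similar:
  assumes "similar_mat_wit A B P Q"
  shows "mat_trace A = mat_trace B"
proof -
  define n where "n = dim_row A"
  have w: "Q * P = 1\<^sub>m n" "A = P * B * Q"
    "B \<in> carrier_mat n n" "P \<in> carrier_mat n n" "Q \<in> carrier_mat n n"
    using assms[unfolded similar_mat_wit_def Let_def, folded n_def] by blast+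
  have "mat_trace A = mat_trace (P * (B * Q))"
    unfolding w(2) by (subst assoc_mult_mat[OF w(4,3,5)]) (rule refl)
  also have "\<dots> = mat_trace (B * Q * P)"
    using w by (intro mat_trace_mult_commute[of _ n n]) auto
  also have "B * Q * P = B"
    unfolding assoc_mult_mat[OF w(3,5,4)] w(1) using w(3) by (rule right_mult_one_mat)
  finally show ?thesis .
qed

text \<open>In the product of \<open>B ^ h\<close> with \<open>B\<close>, a term with
  \<open>l < i\<close> has a vanishing left factor by induction, one with \<open>l > i\<close> a
  vanishing right factor by triangularity, since \<open>j \<le> i < l\<close>; only
  \<open>l = i\<close> survives.\<close>

lemma upper_triangular_pow:
  fixes B :: "'a :: comm_ring_1 mat"
  assumes B: "B \<in> carrier_mat n n" and tri: "upper_triangular B"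
  shows "i < n \<Longrightarrow> j \<le> i \<Longrightarrow> (B ^\<^sub>m h) $$ (i, j) = (if i = j then B $$ (i, i) ^ h else 0)"
proof (induction h arbitrary: i j)
  case 0
  then show ?case using B by auto
next
  case (Suc h)
  have "(B ^\<^sub>m Suc h) $$ (i, j) = (\<Sum>l<n. (B ^\<^sub>m h) $$ (i, l) * B $$ (l, j))"
    using B Suc.prems by (simp add: scalar_prod_def atLeast0LessThan)
  also have "\<dots> = (\<Sum>l<n. if l = i then (if i = j then B $$ (i, i) ^ Suc h else 0) else 0)"
  proof (rule sum.cong[OF refl])
    fix l assume l: "l \<in> {..<n}"
    show "(B ^\<^sub>m h) $$ (i, l) * B $$ (l, j) =
      (if l = i then (if i = j then B $$ (i, i) ^ Suc h else 0) else 0)"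
    proof (cases "l \<le> i")
      case True
      then show ?thesis
        using Suc.IH[OF Suc.prems(1) True] Suc.prems upper_triangularD[OF tri, of j i] B l by auto
    next
      case False
      then show ?thesis using upper_triangularD[OF tri, of j l] Suc.prems B l by auto
    qed
  qed
  also have "\<dots> = (if i = j then B $$ (i, i) ^ Suc h else 0)"
    using Suc.prems by simp
  finally show ?case .
qed

lemma char_poly_neq_0: "A \<in> carrier_mat n n \<Longrightarrow> char_poly (A :: 'a :: field mat) \<noteq> 0"
  using degree_monic_char_poly[of A n] by auto

lemma size_mspectrum: "A \<in> carrier_mat n n \<Longrightarrow> size (mspectrum A) = n"
  using degree_monic_char_poly[of A n] by (simp add: mspectrum_def size_proots_complex)

lemma set_mspectrum: "A \<in> carrier_mat n n \<Longrightarrow> set_mset (mspectrum A) = spectrum A"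
  using char_poly_neq_0[of A n] by (simp add: mspectrum_def spectrum_root_char_poly)

lemma mspectrum_upper_triangular:
  assumes "B \<in> carrier_mat n n" "upper_triangular B"
  shows "mspectrum B = mset (diag_mat B)"
proof -
  have "proots (\<Prod>a\<leftarrow>as. [:- a, 1:]) = mset as" for as :: "complex list"
  proof (induction as)
    case (Cons a as)
    have "(\<Prod>a\<leftarrow>as. [:- a, 1:]) \<noteq> 0" by (auto simp: prod_list_zero_iff)
    then have "proots ([:- a, 1:] * (\<Prod>a\<leftarrow>as. [:- a, 1:])) = proots [:- a, 1:] + mset as"
      using Cons.IH by (subst proots_mult) simp_all
    then show ?case by (simp del: mult_pCons_left)
  qed simp
  then show ?thesis
    unfolding mspectrum_def char_poly_upper_triangular[OF assms] .
qed

text \<open>Schur triangularization reduces this to an upper triangular matrix, whose powers carry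
  the powers of its eigenvalues on the diagonal.\<close>

lemma mat_trace_pow:
  assumes A: "A \<in> carrier_mat n n"
  shows "mat_trace (A ^\<^sub>m h) = (\<Sum>x\<in>#mspectrum A. x ^ h)"
proof -
  obtain B P Q where B: "similar_mat_wit A B P Q" "upper_triangular B"
    using char_poly_factorized[OF A] schur_decomposition[OF A]
    by (metis prod_cases3)
  have cB: "B \<in> carrier_mat n n"
    using A B(1)[unfolded similar_mat_wit_def Let_def] by (metis carrier_matD(1) insert_subset)
  have "mat_trace (A ^\<^sub>m h) = mat_trace (B ^\<^sub>m h)"
    by (rule mat_trace_similar[OF similar_mat_wit_pow[OF B(1)]])
  also have "\<dots> = (\<Sum>i<n. B $$ (i, i) ^ h)"
    using cB upper_triangular_pow[OF cB B(2)] by (simp add: mat_trace_def)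
  also have "\<dots> = (\<Sum>x\<in>#mset (diag_mat B). x ^ h)"
    using cB
    by (simp add: diag_mat_def sum_list_sum_nth atLeast0LessThan sum_mset_sum_list flip: mset_map)
  also have "mset (diag_mat B) = mspectrum A"
    using mspectrum_upper_triangular[OF cB B(2)] B(1)
    using char_poly_similar[of A B] B(1) unfolding mspectrum_def similar_mat_def by metis
  finally show ?thesis .
qed

lemma sum_mset_eq_sum_count:
  fixes f :: "'a \<Rightarrow> 'b :: comm_semiring_1"
  assumes "finite S" "set_mset M \<subseteq> S"
  shows "(\<Sum>x\<in>#M. f x) = (\<Sum>x\<in>S. of_nat (count M x) * f x)"
  using assms(2)
proof (induction M)
  case (add a M)
  have "(\<Sum>x\<in>S. of_nat (count (add_mset a M) x) * f x) =
    (\<Sum>x\<in>S. (if x = a then f x else 0) + of_nat (count M x) * f x)"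
    by (intro sum.cong) (auto simp: algebra_simps)
  also have "\<dots> = f a + (\<Sum>x\<in>#M. f x)"
    using add assms(1) by (simp add: sum.distrib)
  finally show ?case by simp
qed simp

text \<open>Interpolation: a polynomial that vanishes on the joint support except at
  \<open>a\<close> picks out the multiplicity of \<open>a\<close>, and its sum over a multiset is a
  linear combination of power sums. The exponent 0 is among them; without it the multiplicity of 0
  would go undetected.\<close>

lemma multiset_eq_if_power_sums_eq:
  fixes M N :: "'a :: field_char_0 multiset"
  assumes eq: "\<And>h. (\<Sum>x\<in>#M. x ^ h) = (\<Sum>x\<in>#N. x ^ h)"
  shows "M = N"
proof (rule multiset_eqI)
  fix a
  define S where "S = insert a (set_mset M \<union> set_mset N)"
  have S: "finite S" "set_mset M \<subseteq> S" "set_mset N \<subseteq> S" "a \<in> S" by (auto simp: S_def)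
  define p where "p = (\<Prod>y\<in>S - {a}. [:- y, 1:])"
  have pa: "poly p x = 0 \<longleftrightarrow> x \<noteq> a" if "x \<in> S" for x
    using S that by (auto simp: p_def poly_prod)
  have *: "(\<Sum>x\<in>#K. poly p x) = of_nat (count K a) * poly p a" if "set_mset K \<subseteq> S" for K
  proof -
    have "(\<Sum>x\<in>#K. poly p x) = (\<Sum>x\<in>S. if x = a then of_nat (count K a) * poly p a else 0)"
      unfolding sum_mset_eq_sum_count[OF S(1) that]
      by (intro sum.cong) (use pa in auto)
    then show ?thesis using S by simp
  qed
  have **: "(\<Sum>x\<in>#K. poly p x) = (\<Sum>i\<le>degree p. coeff p i * (\<Sum>x\<in>#K. x ^ i))" for K
    by (induction K) (auto simp: poly_altdef algebra_simps sum.distrib)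
  have "of_nat (count M a) * poly p a = of_nat (count N a) * poly p a"
    using *[OF S(2)] *[OF S(3)] eq by (simp add: **)
  then show "count M a = count N a" using pa[OF S(4)] by simp
qed

section \<open>Cesaro means of power sums\<close>

text \<open>For \<open>x \<noteq> z\<close> the ratio \<open>w = x / z\<close> lies in the closed
  unit disc and is not 1, so its geometric sums stay bounded and dividing by \<open>H\<close> sends
  them to 0. The shift \<open>L\<close> affects the numerator only, whence the limit
  \<open>z ^ L\<close>.\<close>

lemma cesaro_power:
  fixes x z :: complex
  assumes "norm x \<le> norm z" "z \<noteq> 0"
  shows "(\<lambda>H. (\<Sum>h<H. x ^ (h + L) / z ^ h) / of_nat H) \<longlonglongrightarrow> (if x = z then z ^ L else 0)"
proof (cases "x = z")
  case True
  have "eventually (\<lambda>H. z ^ L = (\<Sum>h<H. x ^ (h + L) / z ^ h) / of_nat H) sequentially"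
    using eventually_gt_at_top[of 0] by eventually_elim (use assms True in \<open>simp add: power_add\<close>)
  then show ?thesis unfolding if_P[OF True]
    by (intro tendsto_eventually) (simp only: eq_commute[of "z ^ L"])
next
  case False
  define w where "w = x / z"
  have w: "w \<noteq> 1" "norm w \<le> 1"
    using assms False by (auto simp: w_def norm_divide divide_simps)
  have eq: "(\<Sum>h<H. x ^ (h + L) / z ^ h) = x ^ L * ((w ^ H - 1) / (w - 1))" for H
  proof -
    have "(\<Sum>h<H. x ^ (h + L) / z ^ h) = x ^ L * (\<Sum>h<H. w ^ h)"
      by (simp add: w_def power_add power_divide sum_distrib_left mult.commute)
    then show ?thesis using geometric_sum[OF w(1)] by simp
  qed
  define c where "c = norm (x ^ L) * (2 / norm (w - 1))"
  have c0: "c \<ge> 0" by (simp add: c_def)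
  have bound: "norm ((\<Sum>h<H. x ^ (h + L) / z ^ h) / of_nat H) \<le> norm (c / real H) * 1" for H
  proof -
    have "norm (w ^ H - 1) \<le> norm (w ^ H) + 1" using norm_triangle_ineq4[of "w ^ H" 1] by simp
    also have "\<dots> \<le> 2" using w(2) by (simp add: norm_power power_le_one)
    finally have "norm (\<Sum>h<H. x ^ (h + L) / z ^ h) \<le> c"
      unfolding eq c_def norm_mult norm_divide
      by (intro mult_left_mono divide_right_mono) auto
    then show ?thesis using c0 by (simp add: norm_divide divide_right_mono)
  qed
  show ?thesis
    unfolding if_not_P[OF False]
    by (rule tendsto_0_le[OF lim_const_over_n[of c] always_eventually[OF allI[OF bound]]])
qed

text \<open>Averaging removes the eigenvalues of modulus \<open>norm z\<close> other than
  \<open>z\<close>, such as \<open>- \<rho>\<close> for a bipartite graph, whose quotients by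
  \<open>z ^ h\<close> oscillate.\<close>

definition cesaro_mean :: "complex \<Rightarrow> (nat \<Rightarrow> complex) \<Rightarrow> nat \<Rightarrow> complex" where
  "cesaro_mean z f H = (\<Sum>h<H. f h / z ^ h) / of_nat H"

lemma cesaro_mean_power_sum:
  fixes M :: "complex multiset"
  assumes z: "z \<noteq> 0" and le: "\<And>x. x \<in># M \<Longrightarrow> norm x \<le> norm z"
  shows "cesaro_mean z (\<lambda>h. \<Sum>x\<in>#M. x ^ (h + L)) \<longlonglongrightarrow> z ^ L * of_nat (count M z)"
  using le
proof (induction M)
  case empty
  then show ?case by (simp add: cesaro_mean_def)
next
  case (add x M)
  have "(\<lambda>H. cesaro_mean z (\<lambda>h. x ^ (h + L)) H + cesaro_mean z (\<lambda>h. \<Sum>x\<in>#M. x ^ (h + L)) H)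
    \<longlonglongrightarrow> (if x = z then z ^ L else 0) + z ^ L * of_nat (count M z)"
    unfolding cesaro_mean_def[of z "\<lambda>h. x ^ (h + L)"]
    by (intro tendsto_add cesaro_power add.IH) (use add.prems z in auto)
  moreover have "cesaro_mean z (\<lambda>h. x ^ (h + L)) H + cesaro_mean z (\<lambda>h. \<Sum>x\<in>#M. x ^ (h + L)) H
    = cesaro_mean z (\<lambda>h. \<Sum>x\<in>#add_mset x M. x ^ (h + L)) H" for H
    by (simp add: cesaro_mean_def add_divide_distrib sum.distrib)
  ultimately show ?case by (simp add: algebra_simps cong: if_cong split: if_splits)
qed

text \<open>The right side is normalized by \<open>norm z\<close>, so that domination of sequences
  compares the multiplicity of a complex \<open>z\<close> with that of the nonnegative real point on
  the same circle.\<close>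

lemma norm_cesaro_mean_le:
  assumes "\<And>h. norm (f h) \<le> c * g h"
  shows "norm (cesaro_mean z f H) \<le> c * Re (cesaro_mean (of_real (norm z)) (\<lambda>h. of_real (g h)) H)"
proof -
  have "norm (\<Sum>h<H. f h / z ^ h) \<le> c * (\<Sum>h<H. g h / norm z ^ h)"
    unfolding sum_distrib_left
    by (rule order_trans[OF norm_sum], rule sum_mono)
       (use assms in \<open>simp add: norm_divide norm_power divide_right_mono\<close>)
  then have "norm (\<Sum>h<H. f h / z ^ h) / real H \<le> c * (\<Sum>h<H. g h / norm z ^ h) / real H"
    by (rule divide_right_mono) simp
  moreover have "Re (cesaro_mean (of_real (norm z)) (\<lambda>h. of_real (g h)) H)
    = (\<Sum>h<H. g h / norm z ^ h) / real H"
  proof -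
    have "cesaro_mean (of_real (norm z)) (\<lambda>h. of_real (g h)) H
      = of_real ((\<Sum>h<H. g h / norm z ^ h) / real H)"
      by (simp add: cesaro_mean_def)
    then show ?thesis by (metis Re_complex_of_real)
  qed
  ultimately show ?thesis
    by (simp add: cesaro_mean_def norm_divide)
qed

section \<open>The spectral radius of a nonnegative symmetric matrix\<close>

lemma spectral_radius_nonneg:
  assumes "A \<in> carrier_mat n n" "n > 0"
  shows "spectral_radius A \<ge> 0"
  using spectral_radius_mem_max(1)[OF assms] by auto

lemma norm_le_spectral_radius:
  assumes "A \<in> carrier_mat n n" "x \<in># mspectrum A"
  shows "norm x \<le> spectral_radius A"
proof -
  have "n > 0" using assms size_mspectrum[OF assms(1)] by (cases "n = 0") auto
  then show ?thesis
    using assms spectral_radius_mem_max(2)[OF assms(1), of "norm x"] set_mspectrum[OF assms(1)] by blast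
qed

lemma norm_trace_pow_le:
  assumes A: "A \<in> carrier_mat n n"
  shows "norm (mat_trace (A ^\<^sub>m h)) \<le> n * spectral_radius A ^ h"
proof -
  have "norm (\<Sum>x\<in>#M. x ^ h) \<le> real (size M) * r ^ h" if "\<forall>x\<in>#M. norm x \<le> r"
    for M :: "complex multiset" and r
    using that
  proof (induction M)
    case (add x M)
    have "norm (x ^ h) \<le> r ^ h" using add.prems by (simp add: norm_power power_mono)
    then have "norm (x ^ h + (\<Sum>x\<in>#M. x ^ h)) \<le> r ^ h + real (size M) * r ^ h"
      using add by (intro norm_triangle_mono) auto
    then show ?case by (simp add: algebra_simps)
  qed simp
  then show ?thesis
    using norm_le_spectral_radius[OF A] by (simp add: mat_trace_pow[OF A] flip: size_mspectrum[OF A])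
qed

lemma cesaro_mean_trace:
  assumes A: "A \<in> carrier_mat n n" and z: "z \<noteq> 0"
    and "\<And>x. x \<in># mspectrum A \<Longrightarrow> norm x \<le> norm z"
  shows "cesaro_mean z (\<lambda>h. mat_trace (A ^\<^sub>m (h + L))) \<longlonglongrightarrow> z ^ L * of_nat (count (mspectrum A) z)"
  unfolding mat_trace_pow[OF A] by (rule cesaro_mean_power_sum[OF z assms(3)])

text \<open>Both multiplicities are Cesaro limits of traces, so the domination \<open>le\<close>
  passes to the limit. For \<open>norm z\<close> beyond the spectral radius of \<open>A\<close> this
  excludes eigenvalues of \<open>B\<close>; for \<open>B = A\<close> it forces the spectral radius
  itself into the spectrum.\<close>

lemma count_mspectrum_le_if_trace_le:
  assumes A: "A \<in> carrier_mat n n" and B: "B \<in> carrier_mat m m"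
    and t: "\<And>h. mat_trace (A ^\<^sub>m h) = of_real (t h)"
    and le: "\<And>h. norm (mat_trace (B ^\<^sub>m h)) \<le> c * t h"
    and z: "z \<noteq> 0" "\<And>x. x \<in># mspectrum B \<Longrightarrow> norm x \<le> norm z"
    and rz: "spectral_radius A \<le> norm z"
  shows "real (count (mspectrum B) z) \<le> c * count (mspectrum A) (of_real (norm z))"
proof -
  have "cesaro_mean z (\<lambda>h. mat_trace (B ^\<^sub>m (h + 0))) \<longlonglongrightarrow> z ^ 0 * of_nat (count (mspectrum B) z)"
    by (rule cesaro_mean_trace[OF B z])
  then have "(\<lambda>H. norm (cesaro_mean z (\<lambda>h. mat_trace (B ^\<^sub>m h)) H))
    \<longlonglongrightarrow> norm (of_nat (count (mspectrum B) z) :: complex)"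
    by (intro tendsto_norm) simp
  moreover have "cesaro_mean (of_real (norm z)) (\<lambda>h. mat_trace (A ^\<^sub>m (h + 0)))
    \<longlonglongrightarrow> of_real (norm z) ^ 0 * of_nat (count (mspectrum A) (of_real (norm z)))"
    using z norm_le_spectral_radius[OF A] rz by (intro cesaro_mean_trace[OF A]) force+
  then have "(\<lambda>H. c * Re (cesaro_mean (of_real (norm z)) (\<lambda>h. of_real (t h)) H))
    \<longlonglongrightarrow> c * Re (of_nat (count (mspectrum A) (of_real (norm z))))"
    by (intro tendsto_mult tendsto_const tendsto_Re) (simp add: t)
  ultimately have "norm (of_nat (count (mspectrum B) z) :: complex)
    \<le> c * Re (of_nat (count (mspectrum A) (of_real (norm z))))"
    by (rule LIMSEQ_le) (use norm_cesaro_mean_le[of "\<lambda>h. mat_trace (B ^\<^sub>m h)", OF le] in blast)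
  then show ?thesis by simp
qed

lemma norm_le_spectral_radius_if_trace_le:
  assumes A: "A \<in> carrier_mat n n" "n > 0" and B: "B \<in> carrier_mat m m"
    and t: "\<And>h. mat_trace (A ^\<^sub>m h) = of_real (t h)"
    and le: "\<And>h. norm (mat_trace (B ^\<^sub>m h)) \<le> c * t h"
    and x: "x \<in># mspectrum B"
  shows "norm x \<le> spectral_radius A"
proof (rule ccontr)
  assume less: "\<not> norm x \<le> spectral_radius A"
  have fin: "finite (norm ` set_mset (mspectrum B))" "norm ` set_mset (mspectrum B) \<noteq> {}"
    using x by auto
  \<comment> \<open>An eigenvalue of maximal modulus replaces \<open>x\<close>, since the Cesaro
    limit needs every eigenvalue of \<open>B\<close> bounded by \<open>norm z\<close>.\<close>
  obtain z where z: "z \<in># mspectrum B" "norm z = Max (norm ` set_mset (mspectrum B))"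
    using Max_in[OF fin] by auto
  have max: "norm y \<le> norm z" if "y \<in># mspectrum B" for y
    using that fin unfolding z(2) by (intro Max_ge) auto
  have rz: "spectral_radius A < norm z" using less max[OF x] by simp
  then have "z \<noteq> 0" using spectral_radius_nonneg[OF A] by auto
  then have "real (count (mspectrum B) z) \<le> c * count (mspectrum A) (of_real (norm z))"
    using rz max by (intro count_mspectrum_le_if_trace_le[OF A(1) B t le]) auto
  moreover have "complex_of_real (norm z) \<notin># mspectrum A"
    using norm_le_spectral_radius[OF A(1), of "of_real (norm z)"] rz by auto
  then have "count (mspectrum A) (of_real (norm z)) = 0" by (simp add: not_in_iff)
  ultimately have "count (mspectrum B) z = 0" by simp
  then show False using z(1) by (simp add: count_eq_zero_iff)
qed

text \<open>Nonnegative traces dominate themselves, so an eigenvalue \<open>z\<close> of maximal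
  modulus occurs at most as often as \<open>norm z\<close> does.\<close>

lemma spectral_radius_in_mspectrum:
  assumes A: "A \<in> carrier_mat n n" "n > 0"
    and t: "\<And>h. mat_trace (A ^\<^sub>m h) = of_real (t h)" "\<And>h. t h \<ge> 0"
  shows "complex_of_real (spectral_radius A) \<in># mspectrum A"
proof -
  obtain z where z: "z \<in># mspectrum A" "norm z = spectral_radius A"
    using spectral_radius_mem_max(1)[OF A] set_mspectrum[OF A(1)] by auto
  show ?thesis
  proof (cases "z = 0")
    case False
    have "real (count (mspectrum A) z) \<le> (1 :: real) * count (mspectrum A) (of_real (norm z))"
      using False t norm_le_spectral_radius[OF A(1)] z
      by (intro count_mspectrum_le_if_trace_le[OF A(1) A(1) t(1)]) auto
    moreover have "count (mspectrum A) z \<noteq> 0" using z(1) by (simp add: count_eq_zero_iff)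
    ultimately have "count (mspectrum A) (of_real (norm z)) \<noteq> 0" by linarith
    then show ?thesis using z(2) by (simp flip: count_greater_zero_iff)
  qed (use z in auto)
qed

section \<open>Symmetric matrices with real entries\<close>

locale real_symmetric_mat =
  fixes n :: nat and A :: "complex mat" and a :: "nat \<Rightarrow> nat \<Rightarrow> real"
  assumes A: "A \<in> carrier_mat n n" and n: "n > 0"
    and entries: "i < n \<Longrightarrow> j < n \<Longrightarrow> A $$ (i, j) = of_real (a i j)"
    and entries_sym: "a i j = a j i"
begin

definition p :: "nat \<Rightarrow> nat \<Rightarrow> nat \<Rightarrow> real" where
  "p h i j = Re ((A ^\<^sub>m h) $$ (i, j))"

lemma pow_entries: "i < n \<Longrightarrow> j < n \<Longrightarrow> (A ^\<^sub>m h) $$ (i, j) = of_real (p h i j)"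
proof (induction h arbitrary: i j)
  case 0
  then show ?case using A by (simp add: p_def)
next
  case (Suc h)
  have "(A ^\<^sub>m Suc h) $$ (i, j) = (\<Sum>l<n. (A ^\<^sub>m h) $$ (i, l) * A $$ (l, j))"
    using Suc.prems A by (simp add: scalar_prod_def atLeast0LessThan)
  also have "\<dots> = of_real (\<Sum>l<n. p h i l * a l j)"
    using Suc entries by simp
  finally show ?case by (simp add: p_def)
qed

lemma p_Suc:
  assumes "i < n" "j < n"
  shows "p (Suc h) i j = (\<Sum>l<n. p h i l * a l j)"
    "p (Suc h) i j = (\<Sum>l<n. a i l * p h l j)"
proof -
  have "(A ^\<^sub>m Suc h) $$ (i, j) = (\<Sum>l<n. (A ^\<^sub>m h) $$ (i, l) * A $$ (l, j))"
    using assms A by (simp add: scalar_prod_def atLeast0LessThan)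
  also have "\<dots> = of_real (\<Sum>l<n. p h i l * a l j)"
    using assms by (simp add: entries pow_entries)
  finally show "p (Suc h) i j = (\<Sum>l<n. p h i l * a l j)"
    unfolding pow_entries[OF assms] of_real_eq_iff .
  have "(A ^\<^sub>m Suc h) $$ (i, j) = (\<Sum>l<n. A $$ (i, l) * (A ^\<^sub>m h) $$ (l, j))"
    unfolding pow_mat_Suc_left[OF A] using assms A pow_carrier_mat[OF A, of h]
    by (simp add: scalar_prod_def atLeast0LessThan)
  also have "\<dots> = of_real (\<Sum>l<n. a i l * p h l j)"
    using assms by (simp add: entries pow_entries)
  finally show "p (Suc h) i j = (\<Sum>l<n. a i l * p h l j)"
    unfolding pow_entries[OF assms] of_real_eq_iff .
qed

lemma p_sym: "i < n \<Longrightarrow> j < n \<Longrightarrow> p h i j = p h j i"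
proof (induction h arbitrary: i j)
  case 0
  then show ?case using A by (simp add: p_def)
next
  case (Suc h)
  have "p (Suc h) i j = (\<Sum>l<n. p h i l * a l j)" using p_Suc(1) Suc.prems by simp
  also have "\<dots> = (\<Sum>l<n. a j l * p h l i)"
    using Suc by (intro sum.cong) (simp_all add: entries_sym[of _ j])
  also have "\<dots> = p (Suc h) j i" using p_Suc(2) Suc.prems by simp
  finally show ?case .
qed

lemma trace_pow: "mat_trace (A ^\<^sub>m h) = of_real (\<Sum>i<n. p h i i)"
  using A pow_entries by (simp add: mat_trace_def)

text \<open>By symmetry the square of \<open>A ^ h\<close> is \<open>A ^ h\<close> times its
  transpose, whose trace is the squared Frobenius norm.\<close>

lemma sum_p_squared: "(\<Sum>i<n. \<Sum>j<n. (p h i j)\<^sup>2) = Re (mat_trace (A ^\<^sub>m (2 * h)))"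
proof -
  have "A ^\<^sub>m (2 * h) = A ^\<^sub>m h * A ^\<^sub>m h"
    using pow_mat_add[OF A, of h h] by (simp add: mult_2)
  then have "mat_trace (A ^\<^sub>m (2 * h)) = (\<Sum>i<n. \<Sum>j<n. of_real (p h i j * p h j i))"
    using A pow_entries by (simp add: mat_trace_def scalar_prod_def atLeast0LessThan)
  also have "\<dots> = of_real (\<Sum>i<n. \<Sum>j<n. (p h i j)\<^sup>2)"
    unfolding of_real_sum
    by (intro sum.cong refl) (use p_sym in \<open>simp add: power2_eq_square\<close>)
  finally show ?thesis by simp
qed

abbreviation "\<rho> \<equiv> spectral_radius A"

lemma \<rho>_nonneg: "\<rho> \<ge> 0"
  by (rule spectral_radius_nonneg[OF A n])

text \<open>The squared norms of the iterates \<open>A\<^sup>h u\<close> are log-convex and are at most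
  \<open>tr (A\<^sup>2\<^sup>h) \<le> n \<rho>\<^sup>2\<^sup>h\<close> times that of \<open>u\<close>, so their first ratio cannot exceed \<open>\<rho>\<^sup>2\<close>.\<close>

lemma norm_mult_le: "(\<Sum>i<n. (\<Sum>j<n. a i j * u j)\<^sup>2) \<le> \<rho>\<^sup>2 * (\<Sum>i<n. (u i)\<^sup>2)"
proof (rule ccontr)
  define f where "f h i = (\<Sum>j<n. p h i j * u j)" for h i
  define s where "s h = (\<Sum>i<n. (f h i)\<^sup>2)" for h
  have f_0: "f 0 i = u i" if "i < n" for i
  proof -
    have "f 0 i = (\<Sum>j<n. if j = i then u j else 0)"
      unfolding f_def by (intro sum.cong) (use that A in \<open>auto simp: p_def\<close>)
    then show ?thesis using that by simp
  qed
  have f_Suc: "f (Suc h) i = (\<Sum>l<n. a i l * f h l)" if "i < n" for h i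
  proof -
    have "f (Suc h) i = (\<Sum>j<n. \<Sum>l<n. a i l * (p h l j * u j))"
      using that by (simp add: f_def p_Suc(2) sum_distrib_right mult.assoc)
    also have "\<dots> = (\<Sum>l<n. a i l * f h l)"
      by (subst sum.swap) (simp add: f_def sum_distrib_left)
    finally show ?thesis .
  qed
  have s_0: "s 0 = (\<Sum>i<n. (u i)\<^sup>2)" by (simp add: s_def f_0)
  have s_1: "s 1 = (\<Sum>i<n. (\<Sum>j<n. a i j * u j)\<^sup>2)" by (simp add: s_def f_Suc f_0)
  have s_nonneg: "s h \<ge> 0" for h by (simp add: s_def sum_nonneg)
  assume "\<not> (\<Sum>i<n. (\<Sum>j<n. a i j * u j)\<^sup>2) \<le> \<rho>\<^sup>2 * (\<Sum>i<n. (u i)\<^sup>2)"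
  then have less: "\<rho>\<^sup>2 * s 0 < s 1" using s_0 s_1 by simp
  have "s 0 \<noteq> 0"
  proof
    assume 0: "s 0 = 0"
    then have "u i = 0" if "i < n" for i
      using that unfolding s_0 by (subst (asm) sum_nonneg_eq_0_iff) auto
    then have "s 1 = 0" unfolding s_1 by simp
    then show False using less 0 by simp
  qed
  then have s0: "s 0 > 0" using s_nonneg[of 0] by simp
  define q where "q = s 1 / s 0"
  have q: "q > \<rho>\<^sup>2" using less s0 by (simp add: q_def field_simps)
  then have q0: "q > 0" using zero_le_power2[of \<rho>] by linarith
  \<comment> \<open>Symmetry moves one factor \<open>A\<close> across the inner product of
    \<open>f (Suc h)\<close> with itself; Cauchy-Schwarz does the rest.\<close>
  have log_convex: "(s (Suc h))\<^sup>2 \<le> s h * s (Suc (Suc h))" for h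
  proof -
    have "s (Suc h) = (\<Sum>i<n. \<Sum>l<n. a i l * f h l * f (Suc h) i)"
      by (simp add: s_def power2_eq_square f_Suc[of _ h] sum_distrib_right)
    also have "\<dots> = (\<Sum>l<n. f h l * f (Suc (Suc h)) l)"
      by (subst sum.swap)
         (simp add: f_Suc[of _ "Suc h"] sum_distrib_left entries_sym mult_ac)
    finally show ?thesis
      using Cauchy_Schwarz_ineq_sum[of "f h" "f (Suc (Suc h))" "{..<n}"] by (simp add: s_def)
  qed
  \<comment> \<open>Log-convexity makes the ratios \<open>s (Suc h) / s h\<close> nondecreasing, so
    each is at least the first one, \<open>q\<close>.\<close>
  have step: "s h > 0 \<and> s (Suc h) \<ge> q * s h" for h
  proof (induction h)
    case 0
    then show ?case using s0 by (simp add: q_def)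
  next
    case (Suc h)
    then have pos: "s (Suc h) > 0" using q0 by (smt (verit) mult_pos_pos)
    have "q * s h * s (Suc h) \<le> s (Suc h) * s (Suc h)"
      using Suc pos by (intro mult_right_mono) auto
    also have "\<dots> \<le> s h * s (Suc (Suc h))" using log_convex[of h] by (simp add: power2_eq_square)
    finally have "s h * (q * s (Suc h)) \<le> s h * s (Suc (Suc h))" by (simp add: mult_ac)
    then show ?case using Suc pos by simp
  qed
  have lower: "q ^ h * s 0 \<le> s h" for h
  proof (induction h)
    case (Suc h)
    have "q * (q ^ h * s 0) \<le> q * s h" using Suc q0 by (intro mult_left_mono) auto
    then show ?case using step[of h] by simp
  qed simp
  have upper: "s h \<le> n * \<rho> ^ (2 * h) * s 0" for h
  proof -
    have "s h \<le> (\<Sum>i<n. (\<Sum>j<n. (p h i j)\<^sup>2) * (\<Sum>j<n. (u j)\<^sup>2))"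
      unfolding s_def f_def by (intro sum_mono Cauchy_Schwarz_ineq_sum)
    also have "\<dots> = Re (mat_trace (A ^\<^sub>m (2 * h))) * s 0"
      by (simp add: s_0 sum_p_squared flip: sum_distrib_right)
    also have "\<dots> \<le> n * \<rho> ^ (2 * h) * s 0"
      using norm_trace_pow_le[OF A, of "2 * h"] complex_Re_le_cmod s0
      by (intro mult_right_mono) (auto intro: order_trans)
    finally show ?thesis .
  qed
  have q_le: "q ^ h \<le> n * (\<rho>\<^sup>2) ^ h" for h
    using order_trans[OF lower upper, of h] s0 by (simp add: power_mult)
  \<comment> \<open>The instance \<open>h = 1\<close> excludes \<open>\<rho> = 0\<close>, so the
    quotient below makes sense; its powers then outgrow the constant \<open>n\<close>.\<close>
  have "\<rho> \<noteq> 0" using q_le[of 1] q0 by auto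
  then have "\<rho>\<^sup>2 > 0" by simp
  then have "q / \<rho>\<^sup>2 > 1" using q by (simp add: divide_simps)
  then obtain h where "real n < (q / \<rho>\<^sup>2) ^ h" using real_arch_pow by blast
  then have "real n * (\<rho>\<^sup>2) ^ h < q ^ h"
    using \<open>\<rho>\<^sup>2 > 0\<close> by (simp add: power_divide divide_simps)
  then show False using q_le[of h] by simp
qed

end

section \<open>Perron-Frobenius theory for symmetric irreducible nonnegative matrices\<close>

text \<open>Irreducibility is put as an induction rule: an index set that meets the range below
  \<open>n\<close> and is closed along nonzero entries contains that whole range. Both eigenvector
  arguments use it to spread an equation from one index to all.\<close>

locale irreducible_symmetric_mat = real_symmetric_mat +
  assumes nonneg: "a i j \<ge> 0"
    and irreducible:
      "i \<in> S \<Longrightarrow> i < n \<Longrightarrow> (\<And>i j. i \<in> S \<Longrightarrow> i < n \<Longrightarrow> j < n \<Longrightarrow> a i j \<noteq> 0 \<Longrightarrow> j \<in> S) \<Longrightarrow> {..<n} \<subseteq> S"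
begin

lemma p_nonneg: "i < n \<Longrightarrow> j < n \<Longrightarrow> p h i j \<ge> 0"
proof (induction h arbitrary: j)
  case 0
  then show ?case using A by (simp add: p_def)
next
  case (Suc h)
  then show ?case using nonneg by (auto simp: p_Suc(1) intro!: sum_nonneg mult_nonneg_nonneg)
qed

lemma eigenvector_function:
  assumes "B \<in> carrier_mat n n" "x \<in># mspectrum B"
  shows "\<exists>y. (\<exists>i<n. y i \<noteq> 0) \<and> (\<forall>i<n. (\<Sum>j<n. B $$ (i, j) * y j) = x * y i)"
proof -
  have "eigenvalue B x"
    using assms set_mspectrum[OF assms(1)] by (auto simp: spectrum_def)
  then obtain v where v: "v \<in> carrier_vec n" "v \<noteq> 0\<^sub>v n" "B *\<^sub>v v = x \<cdot>\<^sub>v v"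
    using assms(1) by (auto simp: eigenvalue_def eigenvector_def)
  obtain i where "i < n" "v $ i \<noteq> 0"
    using v(1,2) by (metis carrier_vecD eq_vecI index_zero_vec)
  moreover have "(\<Sum>j<n. B $$ (i, j) * v $ j) = x * v $ i" if "i < n" for i
  proof -
    have "(B *\<^sub>v v) $ i = (\<Sum>j<n. B $$ (i, j) * v $ j)"
      using that v(1) assms(1) by (simp add: scalar_prod_def atLeast0LessThan)
    then show ?thesis unfolding v(3) using that v(1) by simp
  qed
  ultimately show ?thesis by blast
qed

text \<open>For the entrywise modulus \<open>u\<close> of an eigenvector, the triangle inequality
  gives \<open>\<rho> * u \<le> A * u\<close> entrywise. As \<open>A\<close> stretches lengths by a
  factor of at most \<open>\<rho>\<close>, equality holds, and a zero of \<open>u\<close> would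
  spread to all indices.\<close>

lemma perron_vector:
  "\<exists>x. (\<forall>i<n. x i > 0) \<and> (\<forall>i<n. (\<Sum>j<n. a i j * x j) = \<rho> * x i)"
proof -
  have mem: "complex_of_real \<rho> \<in># mspectrum A"
    using p_nonneg by (intro spectral_radius_in_mspectrum[OF A n trace_pow]) (auto intro: sum_nonneg)
  obtain y :: "nat \<Rightarrow> complex" and i0 where i0: "i0 < n" "y i0 \<noteq> 0"
    and y: "\<And>i. i < n \<Longrightarrow> (\<Sum>j<n. A $$ (i, j) * y j) = complex_of_real \<rho> * y i"
    using eigenvector_function[OF A mem] by blast
  define u where "u i = cmod (y i)" for i
  have u0: "u i \<ge> 0" for i by (simp add: u_def)
  have le: "\<rho> * u i \<le> (\<Sum>j<n. a i j * u j)" if "i < n" for i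
  proof -
    have "\<rho> * u i = cmod (\<Sum>j<n. A $$ (i, j) * y j)"
      using that \<rho>_nonneg by (simp add: y u_def norm_mult)
    also have "\<dots> \<le> (\<Sum>j<n. a i j * u j)"
      by (rule order_trans[OF norm_sum])
         (use that nonneg in \<open>simp add: entries norm_mult u_def\<close>)
    finally show ?thesis .
  qed
  \<comment> \<open>The slack between the squares: nonnegative termwise by \<open>le\<close>,
    nonpositive in total by \<open>norm_mult_le\<close>.\<close>
  define g where "g i = (\<Sum>j<n. a i j * u j)\<^sup>2 - (\<rho> * u i)\<^sup>2" for i
  have g: "g i \<ge> 0" if "i < n" for i
    using le[OF that] \<rho>_nonneg u0 by (simp add: g_def power_mono)
  have "(\<Sum>i<n. g i) \<le> 0"
    using norm_mult_le[of u] by (simp add: g_def sum_subtractf power_mult_distrib sum_distrib_left)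
  then have "(\<Sum>i<n. g i) = 0"
    using g by (intro antisym sum_nonneg) auto
  then have "g i = 0" if "i < n" for i
    using that g by (subst (asm) sum_nonneg_eq_0_iff) auto
  then have eq: "(\<Sum>j<n. a i j * u j) = \<rho> * u i" if "i < n" for i
    using that u0 nonneg \<rho>_nonneg by (simp add: g_def power2_eq_iff_nonneg sum_nonneg)
  have "u i \<noteq> 0" if i: "i < n" for i
  proof
    assume "u i = 0"
    have "{..<n} \<subseteq> {i. u i = 0}"
    proof (rule irreducible[OF _ i])
      fix i j assume ij: "i \<in> {i. u i = 0}" "i < n" "j < n" "a i j \<noteq> 0"
      then have "(\<Sum>j<n. a i j * u j) = 0" using eq by simp
      then have "a i j * u j = 0"
        using ij u0 nonneg by (subst (asm) sum_nonneg_eq_0_iff) auto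
      then show "j \<in> {i. u i = 0}" using ij by simp
    qed (use \<open>u i = 0\<close> in simp)
    then show False using i0 by (auto simp: u_def)
  qed
  then show ?thesis using eq u0 by (intro exI[of _ u]) (simp add: less_le)
qed

text \<open>With \<open>m\<close> the largest ratio \<open>t i / x i\<close>, the vector
  \<open>m * x - t\<close> is a nonnegative solution of the same eigenvalue equation with a zero
  entry, and its zeros spread to all indices. So \<open>t\<close> is a multiple of the positive
  \<open>x\<close>, and orthogonality leaves only the multiple 0.\<close>

lemma orthogonal_eigenvector_eq_0:
  assumes x: "\<And>i. i < n \<Longrightarrow> x i > 0" "\<And>i. i < n \<Longrightarrow> (\<Sum>j<n. a i j * x j) = \<rho> * x i"
    and t: "\<And>i. i < n \<Longrightarrow> (\<Sum>j<n. a i j * t j) = \<rho> * t i" "(\<Sum>i<n. x i * t i) = 0"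
    and i: "i < n"
  shows "t i = 0"
proof -
  define m where "m = Max ((\<lambda>i. t i / x i) ` {..<n})"
  have fin: "finite ((\<lambda>i. t i / x i) ` {..<n})" "(\<lambda>i. t i / x i) ` {..<n} \<noteq> {}"
    using n by auto
  have le: "t j \<le> m * x j" if "j < n" for j
  proof -
    have "t j / x j \<le> m" unfolding m_def using fin that by (intro Max_ge) auto
    then show ?thesis using x(1)[OF that] by (simp add: divide_simps)
  qed
  obtain i0 where i0: "i0 < n" "t i0 / x i0 = m"
    using Max_in[OF fin] unfolding m_def by auto
  have "{..<n} \<subseteq> {i. t i = m * x i}"
  proof (rule irreducible[OF _ i0(1)])
    show "i0 \<in> {i. t i = m * x i}" using i0 x(1)[OF i0(1)] by (auto simp: field_simps)
  next
    fix i j assume ij: "i \<in> {i. t i = m * x i}" "i < n" "j < n" "a i j \<noteq> 0"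
    have "(\<Sum>j<n. a i j * (m * x j - t j)) = m * (\<Sum>j<n. a i j * x j) - (\<Sum>j<n. a i j * t j)"
      by (simp add: algebra_simps sum_subtractf sum_distrib_left)
    also have "\<dots> = 0" using ij x(2) t(1) by simp
    finally have "a i j * (m * x j - t j) = 0"
      using ij le nonneg by (subst (asm) sum_nonneg_eq_0_iff) auto
    then show "j \<in> {i. t i = m * x i}" using ij by simp
  qed
  then have tm: "t i = m * x i" if "i < n" for i using that by auto
  have "m * (\<Sum>i<n. (x i)\<^sup>2) = 0"
    using t(2) tm by (simp add: sum_distrib_left power2_eq_square mult_ac)
  moreover have "(\<Sum>i<n. (x i)\<^sup>2) > 0"
    using x(1) n by (intro sum_pos) force+
  ultimately show ?thesis using tm[OF i] by simp
qed

text \<open>Subtracting \<open>\<rho> x x\<^sup>T\<close> for the unit Perron vector \<open>x\<close> trades one eigenvalue \<open>\<rho>\<close> for \<open>0\<close>;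
  a second eigenvalue \<open>\<rho>\<close> would leave an eigenvector orthogonal to \<open>x\<close>.\<close>

lemma count_spectral_radius: "count (mspectrum A) (of_real \<rho>) = 1"
proof (cases "\<rho> = 0")
  case True
  \<comment> \<open>For \<open>\<rho> = 0\<close> the deflation below would say nothing. Here the
    trace of \<open>A ^ 2\<close>, a sum of squares, vanishes, so \<open>A = 0\<close>, and
    irreducibility leaves a single index.\<close>
  have zero: "a i j = 0" if ij: "i < n" "j < n" for i j
  proof -
    have "(\<Sum>i<n. \<Sum>j<n. (p 1 i j)\<^sup>2) \<le> 0"
      using norm_trace_pow_le[OF A, of 2] complex_Re_le_cmod[of "mat_trace (A ^\<^sub>m 2)"] True
      by (simp add: sum_p_squared)
    then have "(\<Sum>j<n. (p 1 i j)\<^sup>2) = 0"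
      using ij sum_nonneg_eq_0_iff[of "{..<n}" "\<lambda>i. \<Sum>j<n. (p 1 i j)\<^sup>2"]
      by (auto simp: sum_nonneg antisym)
    then have "p 1 i j = 0"
      using ij by (subst (asm) sum_nonneg_eq_0_iff) auto
    then show ?thesis using ij A entries by (simp add: p_def)
  qed
  have "{..<n} \<subseteq> {0}" by (rule irreducible[of 0]) (use n zero in auto)
  then have "n = 1" using n card_mono[of "{0::nat}" "{..<n}"] by simp
  then have "size (mspectrum A) = 1" using size_mspectrum[OF A] by simp
  then obtain y where y: "mspectrum A = {#y#}" using size_1_singleton_mset by metis
  then have "y = 0" using norm_le_spectral_radius[OF A, of y] True by simp
  then show ?thesis using y True by simp
next
  case False
  obtain x' where x': "\<And>i. i < n \<Longrightarrow> x' i > 0" "\<And>i. i < n \<Longrightarrow> (\<Sum>j<n. a i j * x' j) = \<rho> * x' i"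
    using perron_vector by blast
  define N where "N = sqrt (\<Sum>i<n. (x' i)\<^sup>2)"
  have sum_pos: "(\<Sum>i<n. (x' i)\<^sup>2) > 0" using x'(1) n by (intro sum_pos) force+
  then have N: "N > 0" by (simp add: N_def)
  define x where "x i = x' i / N" for i
  have x: "\<And>i. i < n \<Longrightarrow> x i > 0" "\<And>i. i < n \<Longrightarrow> (\<Sum>j<n. a i j * x j) = \<rho> * x i"
    using x' N by (simp_all add: x_def flip: sum_divide_distrib)
  have unit: "(\<Sum>i<n. x i * x i) = 1"
    using sum_pos by (simp add: x_def N_def power_divide flip: sum_divide_distrib power2_eq_square)
  define B where "B = mat n n (\<lambda>(i, j). complex_of_real (a i j - \<rho> * x i * x j))"
  have B: "B \<in> carrier_mat n n" by (simp add: B_def)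
  have px: "(\<Sum>l<n. p h i l * x l) = \<rho> ^ h * x i" if "i < n" for h i
    using that
  proof (induction h arbitrary: i)
    case 0
    have "(\<Sum>l<n. p 0 i l * x l) = (\<Sum>l<n. if l = i then x i else 0)"
      using 0 A by (intro sum.cong) (auto simp: p_def)
    then show ?case using 0 by simp
  next
    case (Suc h)
    have "(\<Sum>l<n. p (Suc h) i l * x l) = (\<Sum>l<n. \<Sum>m<n. a i m * (p h m l * x l))"
      using Suc.prems by (simp add: p_Suc(2) sum_distrib_right mult.assoc)
    also have "\<dots> = (\<Sum>m<n. a i m * (\<rho> ^ h * x m))"
      by (subst sum.swap) (simp add: Suc.IH flip: sum_distrib_left)
    also have "\<dots> = \<rho> ^ h * (\<Sum>m<n. a i m * x m)" by (simp add: sum_distrib_left mult_ac)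
    finally show ?case using x(2) Suc.prems by simp
  qed
  \<comment> \<open>The cross terms collapse because \<open>x\<close> is a unit eigenvector. The
    formula fails for the exponent 0, hence the shape \<open>Suc h\<close>.\<close>
  have Bpow: "(B ^\<^sub>m Suc h) $$ (i, j) = of_real (p (Suc h) i j - \<rho> ^ Suc h * x i * x j)"
    if "i < n" "j < n" for h i j
    using that
  proof (induction h arbitrary: i j)
    case 0
    then have "p (Suc 0) i j = a i j" using A entries by (simp add: p_def)
    then show ?case using 0 by (simp add: B_def)
  next
    case (Suc h)
    have "(B ^\<^sub>m Suc (Suc h)) $$ (i, j) = (\<Sum>l<n. (B ^\<^sub>m Suc h) $$ (i, l) * B $$ (l, j))"
      unfolding pow_mat.simps(2)[of B "Suc h"]
      using Suc.prems B pow_carrier_mat[OF B, of "Suc h"]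
      by (simp add: scalar_prod_def atLeast0LessThan del: pow_mat.simps)
    also have "\<dots> = of_real (\<Sum>l<n. (p (Suc h) i l - \<rho> ^ Suc h * x i * x l) * (a l j - \<rho> * x l * x j))"
      using Suc by (simp add: B_def del: pow_mat.simps)
    also have "(\<Sum>l<n. (p (Suc h) i l - \<rho> ^ Suc h * x i * x l) * (a l j - \<rho> * x l * x j)) =
      (\<Sum>l<n. p (Suc h) i l * a l j) - \<rho> * x j * (\<Sum>l<n. p (Suc h) i l * x l)
      - \<rho> ^ Suc h * x i * (\<Sum>l<n. a j l * x l) + \<rho> ^ Suc h * x i * \<rho> * x j * (\<Sum>l<n. x l * x l)"
      by (simp add: sum_distrib_left sum_subtractf sum.distrib entries_sym[of j] algebra_simps)
    also have "\<dots> = p (Suc (Suc h)) i j - \<rho> ^ Suc (Suc h) * x i * x j"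
      using Suc.prems px x(2) unit by (simp add: p_Suc(1)[of i j "Suc h"])
    finally show ?case .
  qed
  have "mspectrum A + {#0#} = mspectrum B + {#of_real \<rho>#}"
  proof (rule multiset_eq_if_power_sums_eq)
    fix h
    \<comment> \<open>At \<open>h = 0\<close> both sides are \<open>n + 1\<close>, since
      \<open>0 ^ 0 = 1\<close>.\<close>
    have "mat_trace (A ^\<^sub>m h) + 0 ^ h = mat_trace (B ^\<^sub>m h) + of_real \<rho> ^ h"
    proof (cases h)
      case 0
      then show ?thesis using A B by (simp add: mat_trace_def)
    next
      case (Suc h')
      have "mat_trace (B ^\<^sub>m h) = of_real (\<Sum>i<n. p h i i - \<rho> ^ h * (x i * x i))"
        using B Bpow by (simp add: mat_trace_def Suc mult.assoc del: pow_mat.simps)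
      also have "\<dots> = mat_trace (A ^\<^sub>m h) - of_real \<rho> ^ h"
        by (simp add: sum_subtractf trace_pow unit flip: sum_distrib_left)
      finally show ?thesis using Suc by simp
    qed
    then show "(\<Sum>y\<in>#mspectrum A + {#0#}. y ^ h) = (\<Sum>y\<in>#mspectrum B + {#of_real \<rho>#}. y ^ h)"
      by (simp add: mat_trace_pow[OF A] mat_trace_pow[OF B] add.commute)
  qed
  then have "count (mspectrum A + {#0#}) (of_real \<rho>) = count (mspectrum B + {#of_real \<rho>#}) (of_real \<rho>)"
    by simp
  then have count: "count (mspectrum A) (of_real \<rho>) = count (mspectrum B) (of_real \<rho>) + 1"
    using False by simp
  have "of_real \<rho> \<notin># mspectrum B"
  proof
    assume mem: "complex_of_real \<rho> \<in># mspectrum B"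
    obtain y :: "nat \<Rightarrow> complex" and i0 where i0: "i0 < n" "y i0 \<noteq> 0"
      and y: "\<And>i. i < n \<Longrightarrow> (\<Sum>j<n. B $$ (i, j) * y j) = complex_of_real \<rho> * y i"
      using eigenvector_function[OF B mem] by blast
    define c where "c = (\<Sum>j<n. of_real (x j) * y j)"
    have ay: "(\<Sum>j<n. of_real (a i j) * y j) = \<rho> * y i + \<rho> * x i * c" if "i < n" for i
      using y[OF that] that
      by (simp add: B_def c_def algebra_simps sum_subtractf sum_distrib_left)
    \<comment> \<open>The pairing of \<open>x\<close> with \<open>A y\<close> is evaluated twice:
      moving \<open>A\<close> over to \<open>x\<close> gives \<open>\<rho> * c\<close>, while
      \<open>ay\<close> gives \<open>2 * \<rho> * c\<close>; hence \<open>c = 0\<close>.\<close>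
    have "(\<Sum>i<n. of_real (x i) * (\<Sum>j<n. of_real (a i j) * y j)) =
      (\<Sum>j<n. of_real (\<Sum>i<n. a j i * x i) * y j)"
      unfolding sum_distrib_left of_real_sum sum_distrib_right
      by (subst sum.swap) (simp add: entries_sym mult_ac)
    also have "\<dots> = \<rho> * c" using x(2) by (simp add: c_def sum_distrib_left mult_ac)
    finally have "(\<Sum>i<n. of_real (x i) * (\<rho> * y i + \<rho> * x i * c)) = \<rho> * c"
      by (simp add: ay)
    moreover have "(\<Sum>i<n. of_real (x i) * (\<rho> * y i + \<rho> * x i * c)) =
      \<rho> * (\<Sum>i<n. of_real (x i) * y i) + \<rho> * c * of_real (\<Sum>i<n. x i * x i)"
      by (simp add: sum.distrib sum_distrib_left algebra_simps)
    ultimately have c: "c = 0" using False unit by (simp flip: c_def)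
    \<comment> \<open>With \<open>c = 0\<close>, \<open>ay\<close> says that \<open>y\<close> is an
      eigenvector of the real matrix \<open>a\<close>, so its real and imaginary parts satisfy the
      equation separately.\<close>
    have "Re (y i) = 0" if "i < n" for i
    proof (rule orthogonal_eigenvector_eq_0[OF x _ _ that])
      show "(\<Sum>j<n. a i j * Re (y j)) = \<rho> * Re (y i)" if "i < n" for i
        using arg_cong[OF ay[OF that], of Re] c by simp
      show "(\<Sum>i<n. x i * Re (y i)) = 0"
        using arg_cong[OF c[unfolded c_def], of Re] by simp
    qed
    moreover have "Im (y i) = 0" if "i < n" for i
    proof (rule orthogonal_eigenvector_eq_0[OF x _ _ that])
      show "(\<Sum>j<n. a i j * Im (y j)) = \<rho> * Im (y i)" if "i < n" for i
        using arg_cong[OF ay[OF that], of Im] c by simp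
      show "(\<Sum>i<n. x i * Im (y i)) = 0"
        using arg_cong[OF c[unfolded c_def], of Im] by simp
    qed
    ultimately show False using i0 by (auto simp: complex_eq_iff)
  qed
  then show ?thesis using count by (simp add: not_in_iff)
qed

end

section \<open>Unitary matrices\<close>

lemma unitary_mat_row_norm:
  assumes U: "U \<in> carrier_mat k k" "unitary_mat U" and a: "a < k"
  shows "(\<Sum>b<k. (cmod (U $$ (a, b)))\<^sup>2) = 1"
proof -
  have "U * mat_adjoint U = 1\<^sub>m k" using U by (simp add: unitary_mat_def)
  then have "(U * mat_adjoint U) $$ (a, a) = 1" using a by simp
  moreover have "(U * mat_adjoint U) $$ (a, a) = (\<Sum>b<k. U $$ (a, b) * cnj (U $$ (a, b)))"
    using U a mat_adjoint_carrier[OF U(1)]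
    by (simp add: scalar_prod_def mat_adjoint_index atLeast0LessThan)
  ultimately have "complex_of_real (\<Sum>b<k. (cmod (U $$ (a, b)))\<^sup>2) = 1"
    by (simp add: complex_norm_square del: of_real_power)
  then show ?thesis by (metis of_real_eq_1_iff)
qed

lemma unitary_mat_diag_le_1:
  assumes U: "U \<in> carrier_mat k k" "unitary_mat U" and a: "a < k"
  shows "cmod (U $$ (a, a)) \<le> 1"
proof -
  have "(cmod (U $$ (a, a)))\<^sup>2 \<le> (\<Sum>b<k. (cmod (U $$ (a, b)))\<^sup>2)"
    using a by (intro member_le_sum) auto
  then show ?thesis
    unfolding unitary_mat_row_norm[OF assms] by (simp add: power_le_one_iff)
qed

lemma unitary_mat_norm_trace_le:
  assumes U: "U \<in> carrier_mat k k" "unitary_mat U"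
  shows "cmod (mat_trace U) \<le> k"
proof -
  have "cmod (mat_trace U) \<le> (\<Sum>a<k. cmod (U $$ (a, a)))"
    using U by (simp add: mat_trace_def norm_sum)
  also have "\<dots> \<le> (\<Sum>a<k. 1)"
    by (intro sum_mono unitary_mat_diag_le_1[OF U]) auto
  finally show ?thesis by simp
qed

text \<open>Diagonal entries lie in the closed unit disc, so a full trace forces each of them to be
  1; rows have norm 1, which leaves nothing off the diagonal.\<close>

lemma unitary_mat_Re_trace_eq_imp_one:
  assumes U: "U \<in> carrier_mat k k" "unitary_mat U" and tr: "Re (mat_trace U) = k"
  shows "U = 1\<^sub>m k"
proof (rule eq_matI)
  have diag: "U $$ (a, a) = 1" if a: "a < k" for a
  proof -
    have le: "Re (U $$ (b, b)) \<le> 1" if "b < k" for b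
      using unitary_mat_diag_le_1[OF U that] complex_Re_le_cmod[of "U $$ (b, b)"] by linarith
    have "(\<Sum>b<k. 1 - Re (U $$ (b, b))) = 0"
      using tr U by (simp add: mat_trace_def sum_subtractf)
    then have "1 - Re (U $$ (a, a)) = 0"
      using sum_nonneg_eq_0_iff[of "{..<k}" "\<lambda>b. 1 - Re (U $$ (b, b))"] le a by auto
    moreover have "(cmod (U $$ (a, a)))\<^sup>2 \<le> 1"
      using unitary_mat_diag_le_1[OF U a] by (simp add: power_le_one)
    ultimately show ?thesis by (auto simp: cmod_power2 complex_eq_iff)
  qed
  fix i j assume "i < dim_row (1\<^sub>m k :: complex mat)" "j < dim_col (1\<^sub>m k :: complex mat)"
  then have ij: "i < k" "j < k" by auto
  show "U $$ (i, j) = 1\<^sub>m k $$ (i, j)"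
  proof (cases "i = j")
    case False
    have "(\<Sum>b<k. (cmod (U $$ (i, b)))\<^sup>2) =
      (cmod (U $$ (i, i)))\<^sup>2 + (\<Sum>b\<in>{..<k} - {i}. (cmod (U $$ (i, b)))\<^sup>2)"
      using ij by (intro sum.remove) auto
    then have "(\<Sum>b\<in>{..<k} - {i}. (cmod (U $$ (i, b)))\<^sup>2) = 0"
      using unitary_mat_row_norm[OF U ij(1)] diag[OF ij(1)] by simp
    then have "(cmod (U $$ (i, j)))\<^sup>2 = 0"
      using ij False by (subst (asm) sum_nonneg_eq_0_iff) auto
    then show ?thesis using ij False by simp
  qed (use diag ij in auto)
qed (use U in auto)

section \<open>Closed walks and the trace formula\<close>

definition walks :: "'v pair_pre_digraph \<Rightarrow> nat \<Rightarrow> 'v \<Rightarrow> 'v \<Rightarrow> 'v vwalk set" where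
  "walks \<Gamma> h u v = {w. vwalk w (with_proj \<Gamma>) \<and> length w = Suc h \<and> hd w = u \<and> last w = v}"

text \<open>Closed walks are based at their first vertex: distinct rotations count separately, as
  the trace requires.\<close>

definition closed_walks :: "'v pair_pre_digraph \<Rightarrow> nat \<Rightarrow> 'v vwalk set" where
  "closed_walks \<Gamma> h = {w. vwalk w (with_proj \<Gamma>) \<and> length w = Suc h \<and> hd w = last w}"

lemma walks_0: "walks \<Gamma> 0 u v = (if u = v \<and> u \<in> pverts \<Gamma> then {[u]} else {})"
  by (auto simp: walks_def vwalk_def length_Suc_conv)

text \<open>Splitting off the first edge matches both \<open>walk_gain\<close>, a right fold, and
  left multiplication by the matrix.\<close>

lemma walks_Suc:
  assumes "pair_graph \<Gamma>"
  shows "walks \<Gamma> (Suc h) u v = (\<Union>x\<in>{x. (u, x) \<in> parcs \<Gamma>}. (#) u ` walks \<Gamma> h x v)"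
proof -
  interpret pair_graph \<Gamma> by fact
  show ?thesis
  proof (intro equalityI subsetI)
    fix w assume w: "w \<in> walks \<Gamma> (Suc h) u v"
    then obtain y w' where "w = u # y # w'"
      by (auto simp: walks_def length_Suc_conv)
    then show "w \<in> (\<Union>x\<in>{x. (u, x) \<in> parcs \<Gamma>}. (#) u ` walks \<Gamma> h x v)"
      using w by (auto simp: walks_def vwalk_def)
  next
    fix w assume "w \<in> (\<Union>x\<in>{x. (u, x) \<in> parcs \<Gamma>}. (#) u ` walks \<Gamma> h x v)"
    then obtain x w' where "(u, x) \<in> parcs \<Gamma>" "w' \<in> walks \<Gamma> h x v" "w = u # w'" by auto
    then show "w \<in> walks \<Gamma> (Suc h) u v"
      using arc_fst_in_verts[of "(u, x)"]
      by (cases w') (auto simp: walks_def vwalk_def)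
  qed
qed

lemma finite_walks:
  assumes "pair_graph \<Gamma>"
  shows "finite (walks \<Gamma> h u v)" "finite (closed_walks \<Gamma> h)"
proof -
  interpret pair_graph \<Gamma> by fact
  have "finite {xs. set xs \<subseteq> pverts \<Gamma> \<and> length xs = Suc h}"
    by (rule finite_lists_length_eq[OF pair_finite_verts])
  then show "finite (walks \<Gamma> h u v)" "finite (closed_walks \<Gamma> h)"
    by (auto simp: walks_def closed_walks_def vwalk_def elim!: rev_finite_subset)
qed

lemma sum_closed_walks:
  assumes "pair_graph \<Gamma>"
  shows "(\<Sum>v\<in>pverts \<Gamma>. \<Sum>w\<in>walks \<Gamma> h v v. f w) = (\<Sum>w\<in>closed_walks \<Gamma> h. f w)"
proof -
  interpret pair_graph \<Gamma> by fact
  have "closed_walks \<Gamma> h = (\<Union>v\<in>pverts \<Gamma>. walks \<Gamma> h v v)"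
    using last_in_set by (fastforce simp: closed_walks_def walks_def vwalk_def)
  moreover have "(\<Sum>w\<in>(\<Union>v\<in>pverts \<Gamma>. walks \<Gamma> h v v). f w) = (\<Sum>v\<in>pverts \<Gamma>. \<Sum>w\<in>walks \<Gamma> h v v. f w)"
    using pair_finite_verts finite_walks[OF assms]
    by (intro sum.UNION_disjoint) (auto simp: walks_def)
  ultimately show ?thesis by simp
qed

lemma walk_gain_singleton: "walk_gain G \<Psi> [u] = \<one>\<^bsub>G\<^esub>"
  by (simp add: walk_gain_def)

lemma walk_gain_Cons:
  "w \<noteq> [] \<Longrightarrow> walk_gain G \<Psi> (u # w) = \<Psi> (u, hd w) \<otimes>\<^bsub>G\<^esub> walk_gain G \<Psi> w"
  by (cases w) (auto simp: walk_gain_def)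

lemma walk_gain_closed:
  assumes "group G" and gain: "\<And>e. e \<in> parcs \<Gamma> \<Longrightarrow> \<Psi> e \<in> carrier G"
    and "vwalk w (with_proj \<Gamma>)"
  shows "walk_gain G \<Psi> w \<in> carrier G"
proof -
  interpret group G by fact
  have "set (vwalk_arcs w) \<subseteq> parcs \<Gamma>" using assms(3) by (auto simp: vwalk_def)
  moreover have "set es \<subseteq> parcs \<Gamma> \<Longrightarrow> foldr (\<lambda>e x. \<Psi> e \<otimes>\<^bsub>G\<^esub> x) es \<one>\<^bsub>G\<^esub> \<in> carrier G" for es
    by (induction es) (use gain in auto)
  ultimately show ?thesis by (simp add: walk_gain_def)
qed

section \<open>Block coordinates and powers of the represented adjacency matrix\<close>

lemma sum_lessThan_times:
  fixes f :: "nat \<Rightarrow> 'a :: comm_monoid_add"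
  shows "(\<Sum>r<n * k. f r) = (\<Sum>i<n. \<Sum>a<k. f (i * k + a))"
proof -
  have "(\<Sum>a<k. f (i * k + a)) = sum f {i * k..<i * k + k}" for i
    using sum.shift_bounds_nat_ivl[of f 0 "i * k" k]
    by (simp add: atLeast0LessThan add.commute)
  then show ?thesis by (simp add: sum.nat_group)
qed

text \<open>Besides the given data, the trivial representation of degree 1 and the constant gain
  \<open>\<one>\<close> are instances, so one trace formula serves \<open>rep_adjacency_mat\<close>,
  \<open>adjacency_mat\<close> and \<open>abs_rep_adjacency_mat\<close>.\<close>

locale represented_gain_graph =
  fixes G :: "('g, 'm) monoid_scheme"
    and k :: nat
    and \<pi> :: "'g \<Rightarrow> complex mat"
    and \<Gamma> :: "'v pair_pre_digraph"
    and \<Psi> :: "'v \<times> 'v \<Rightarrow> 'g"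
    and vs :: "'v list"
  assumes group: "group G"
    and rep: "unitary_representation G k \<pi>"
    and graph: "pair_graph \<Gamma>"
    and gain: "e \<in> parcs \<Gamma> \<Longrightarrow> \<Psi> e \<in> carrier G"
    and vs: "distinct vs" "set vs = pverts \<Gamma>"
begin

abbreviation "n \<equiv> length vs"

abbreviation "A\<pi> \<equiv> rep_adjacency_mat k \<pi> \<Gamma> \<Psi> vs"

lemma index_less: "i < n \<Longrightarrow> a < k \<Longrightarrow> i * k + a < n * k"
proof -
  assume "i < n" "a < k"
  then have "i * k + a < Suc i * k" by simp
  also have "\<dots> \<le> n * k" using \<open>i < n\<close> by (intro mult_le_mono1) simp
  finally show ?thesis .
qed

lemma A\<pi>_carrier: "A\<pi> \<in> carrier_mat (n * k) (n * k)"
  by (simp add: rep_adjacency_mat_def)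

lemma A\<pi>_index:
  assumes "i < n" "j < n" "a < k" "b < k"
  shows "A\<pi> $$ (i * k + a, j * k + b) =
    (if (vs ! i, vs ! j) \<in> parcs \<Gamma> then \<pi> (\<Psi> (vs ! i, vs ! j)) $$ (a, b) else 0)"
proof -
  show ?thesis
    using assms index_less[of i a] index_less[of j b] by (simp add: rep_adjacency_mat_def Let_def)
qed

lemma \<pi>_unitary:
  assumes "x \<in> carrier G"
  shows "\<pi> x \<in> carrier_mat k k" "unitary_mat (\<pi> x)"
  using rep assms by (auto simp: unitary_representation_def hom_def unitary_group_def)

lemma \<pi>_mult: "x \<in> carrier G \<Longrightarrow> y \<in> carrier G \<Longrightarrow> \<pi> (x \<otimes>\<^bsub>G\<^esub> y) = \<pi> x * \<pi> y"
  using rep by (auto simp: unitary_representation_def hom_def unitary_group_def)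

lemma \<pi>_one: "\<pi> \<one>\<^bsub>G\<^esub> = 1\<^sub>m k"
  using hom_one[OF rep[unfolded unitary_representation_def] group group_unitary_group]
  by (simp add: unitary_group_def)

lemma gain_walks: "w \<in> walks \<Gamma> h u v \<Longrightarrow> walk_gain G \<Psi> w \<in> carrier G"
  "w \<in> closed_walks \<Gamma> h \<Longrightarrow> walk_gain G \<Psi> w \<in> carrier G"
  using walk_gain_closed[OF group gain] by (auto simp: walks_def closed_walks_def)

lemma sum_vs: "(\<Sum>i<n. f (vs ! i)) = (\<Sum>v\<in>pverts \<Gamma>. f v)"
  using sum.reindex_bij_betw[OF bij_betw_nth[OF vs(1) refl vs(2)[symmetric]]] .

text \<open>Induction on the first edge: the block of an edge to a neighbour is multiplied into the
  sum over the walks starting there, and as \<open>\<pi>\<close> is multiplicative the products are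
  the images of the gains of the prolonged walks.\<close>

lemma A\<pi>_pow_index:
  assumes "i < n" "j < n" "a < k" "b < k"
  shows "(A\<pi> ^\<^sub>m h) $$ (i * k + a, j * k + b) =
    (\<Sum>w\<in>walks \<Gamma> h (vs ! i) (vs ! j). \<pi> (walk_gain G \<Psi> w) $$ (a, b))"
proof -
  interpret \<Gamma>: pair_graph \<Gamma> by (rule graph)
  show ?thesis
    using assms(1,3)
  proof (induction h arbitrary: i a)
    case 0
    have "i * k + a = j * k + b \<longleftrightarrow> i = j \<and> a = b"
    proof
      assume eq: "i * k + a = j * k + b"
      have "(i * k + a) div k = (j * k + b) div k" "(i * k + a) mod k = (j * k + b) mod k"
        using eq by simp_all
      then show "i = j \<and> a = b" using 0 assms by simp
    qed simp
    moreover have "vs ! i = vs ! j \<longleftrightarrow> i = j" "vs ! i \<in> pverts \<Gamma>"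
      using nth_eq_iff_index_eq[OF vs(1), of i j] nth_mem[of i vs] 0 assms by (simp_all add: vs(2))
    ultimately show ?case
      using 0 assms index_less[of i a] index_less[of j b] A\<pi>_carrier by (simp add: walks_0 walk_gain_singleton \<pi>_one)
  next
    case (Suc h)
    let ?W = "\<lambda>x. walks \<Gamma> h x (vs ! j)"
    let ?u = "vs ! i"
    have step: "(\<Sum>c<k. A\<pi> $$ (i * k + a, l * k + c) * (A\<pi> ^\<^sub>m h) $$ (l * k + c, j * k + b)) =
      (if (?u, vs ! l) \<in> parcs \<Gamma>
       then \<Sum>w\<in>?W (vs ! l). \<pi> (walk_gain G \<Psi> (?u # w)) $$ (a, b) else 0)" if l: "l < n" for l
    proof (cases "(?u, vs ! l) \<in> parcs \<Gamma>")
      case True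
      define P where "P = \<pi> (\<Psi> (?u, vs ! l))"
      have P: "P \<in> carrier_mat k k" using \<pi>_unitary gain[OF True] by (simp add: P_def)
      have "(\<Sum>c<k. A\<pi> $$ (i * k + a, l * k + c) * (A\<pi> ^\<^sub>m h) $$ (l * k + c, j * k + b)) =
        (\<Sum>c<k. \<Sum>w\<in>?W (vs ! l). P $$ (a, c) * \<pi> (walk_gain G \<Psi> w) $$ (c, b))"
        using Suc l assms True
        by (intro sum.cong) (simp_all add: A\<pi>_index sum_distrib_left P_def)
      also have "\<dots> = (\<Sum>w\<in>?W (vs ! l). \<Sum>c<k. P $$ (a, c) * \<pi> (walk_gain G \<Psi> w) $$ (c, b))"
        by (rule sum.swap)
      also have "\<dots> = (\<Sum>w\<in>?W (vs ! l). \<pi> (walk_gain G \<Psi> (?u # w)) $$ (a, b))"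
      proof (rule sum.cong[OF refl])
        fix w assume w: "w \<in> ?W (vs ! l)"
        then have "w \<noteq> []" "hd w = vs ! l" by (auto simp: walks_def)
        then have "\<pi> (walk_gain G \<Psi> (?u # w)) = P * \<pi> (walk_gain G \<Psi> w)"
          using gain[OF True] gain_walks(1)[OF w] by (simp add: walk_gain_Cons \<pi>_mult P_def)
        then show "(\<Sum>c<k. P $$ (a, c) * \<pi> (walk_gain G \<Psi> w) $$ (c, b)) =
          \<pi> (walk_gain G \<Psi> (?u # w)) $$ (a, b)"
          using P \<pi>_unitary(1)[OF gain_walks(1)[OF w]] Suc.prems assms
          by (simp add: scalar_prod_def atLeast0LessThan)
      qed
      finally show ?thesis using True by simp
    qed (use Suc l assms in \<open>simp add: A\<pi>_index\<close>)
    have "(A\<pi> ^\<^sub>m Suc h) $$ (i * k + a, j * k + b) =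
      (\<Sum>r<n * k. A\<pi> $$ (i * k + a, r) * (A\<pi> ^\<^sub>m h) $$ (r, j * k + b))"
      unfolding pow_mat_Suc_left[OF A\<pi>_carrier]
      using Suc.prems assms index_less[of i a] index_less[of j b] A\<pi>_carrier pow_carrier_mat[OF A\<pi>_carrier, of h]
      by (simp add: scalar_prod_def atLeast0LessThan)
    also have "\<dots> = (\<Sum>l<n. if (?u, vs ! l) \<in> parcs \<Gamma>
       then \<Sum>w\<in>?W (vs ! l). \<pi> (walk_gain G \<Psi> (?u # w)) $$ (a, b) else 0)"
      unfolding sum_lessThan_times by (intro sum.cong[OF refl] step) auto
    also have "\<dots> = (\<Sum>x\<in>pverts \<Gamma>. if (?u, x) \<in> parcs \<Gamma>
       then \<Sum>w\<in>?W x. \<pi> (walk_gain G \<Psi> (?u # w)) $$ (a, b) else 0)"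
      by (rule sum_vs)
    also have "\<dots> = (\<Sum>x\<in>{x. (?u, x) \<in> parcs \<Gamma>}. \<Sum>w\<in>?W x. \<pi> (walk_gain G \<Psi> (?u # w)) $$ (a, b))"
      using \<Gamma>.pair_finite_verts \<Gamma>.arc_snd_in_verts[of "(?u, _)"]
      by (subst sum.inter_filter[symmetric]) (auto intro!: sum.cong)
    also have "\<dots> = (\<Sum>x\<in>{x. (?u, x) \<in> parcs \<Gamma>}. \<Sum>w\<in>(#) ?u ` ?W x. \<pi> (walk_gain G \<Psi> w) $$ (a, b))"
      by (simp add: sum.reindex)
    also have "\<dots> = (\<Sum>w\<in>walks \<Gamma> (Suc h) ?u (vs ! j). \<pi> (walk_gain G \<Psi> w) $$ (a, b))"
      unfolding walks_Suc[OF graph]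
    proof (rule sum.UNION_disjoint[symmetric])
      show "finite {x. (?u, x) \<in> parcs \<Gamma>}"
        using \<Gamma>.arc_snd_in_verts[of "(?u, _)"]
        by (intro finite_subset[OF _ \<Gamma>.pair_finite_verts]) auto
    qed (use finite_walks[OF graph] in \<open>auto simp: walks_def\<close>)
    finally show ?case .
  qed
qed

lemma trace_A\<pi>_pow:
  "mat_trace (A\<pi> ^\<^sub>m h) = (\<Sum>w\<in>closed_walks \<Gamma> h. mat_trace (\<pi> (walk_gain G \<Psi> w)))"
proof -
  have "mat_trace (A\<pi> ^\<^sub>m h) = (\<Sum>i<n. \<Sum>a<k. (A\<pi> ^\<^sub>m h) $$ (i * k + a, i * k + a))"
    using A\<pi>_carrier by (simp add: mat_trace_def sum_lessThan_times)
  also have "\<dots> = (\<Sum>i<n. \<Sum>w\<in>walks \<Gamma> h (vs ! i) (vs ! i). mat_trace (\<pi> (walk_gain G \<Psi> w)))"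
  proof (rule sum.cong[OF refl])
    fix i assume i: "i \<in> {..<n}"
    have "(\<Sum>a<k. (A\<pi> ^\<^sub>m h) $$ (i * k + a, i * k + a)) =
      (\<Sum>a<k. \<Sum>w\<in>walks \<Gamma> h (vs ! i) (vs ! i). \<pi> (walk_gain G \<Psi> w) $$ (a, a))"
      using i by (intro sum.cong) (simp_all add: A\<pi>_pow_index)
    also have "\<dots> = (\<Sum>w\<in>walks \<Gamma> h (vs ! i) (vs ! i). \<Sum>a<k. \<pi> (walk_gain G \<Psi> w) $$ (a, a))"
      by (rule sum.swap)
    also have "\<dots> = (\<Sum>w\<in>walks \<Gamma> h (vs ! i) (vs ! i). mat_trace (\<pi> (walk_gain G \<Psi> w)))"
      using carrier_matD(1)[OF \<pi>_unitary(1)[OF gain_walks(1)]]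
      by (intro sum.cong) (simp_all add: mat_trace_def)
    finally show "(\<Sum>a<k. (A\<pi> ^\<^sub>m h) $$ (i * k + a, i * k + a)) =
      (\<Sum>w\<in>walks \<Gamma> h (vs ! i) (vs ! i). mat_trace (\<pi> (walk_gain G \<Psi> w)))" .
  qed
  also have "\<dots> = (\<Sum>w\<in>closed_walks \<Gamma> h. mat_trace (\<pi> (walk_gain G \<Psi> w)))"
    unfolding sum_vs[of "\<lambda>v. \<Sum>w\<in>walks \<Gamma> h v v. mat_trace (\<pi> (walk_gain G \<Psi> w))"]
    by (rule sum_closed_walks[OF graph])
  finally show ?thesis .
qed

end

section \<open>Connectivity, joined walks and bipartite graphs\<close>

text \<open>The induction principle of a connected graph. Connectedness is strong connectedness of
  the symmetric closure; as the arcs of \<open>\<Gamma>\<close> are symmetric already, reachability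
  there follows arcs of \<open>\<Gamma>\<close> only.\<close>

lemma connected_closed_under_adjacency:
  assumes "pair_graph \<Gamma>" "Digraph_Component.connected (with_proj \<Gamma>)"
    and v: "v \<in> S" "v \<in> pverts \<Gamma>"
    and closed: "\<And>u x. u \<in> S \<Longrightarrow> (u, x) \<in> parcs \<Gamma> \<Longrightarrow> x \<in> S"
  shows "pverts \<Gamma> \<subseteq> S"
proof
  interpret pair_graph \<Gamma> by fact
  let ?H = "with_proj (mk_symmetric (with_proj \<Gamma>))"
  fix x assume "x \<in> pverts \<Gamma>"
  then have "v \<rightarrow>\<^sup>*\<^bsub>?H\<^esub> x"
    using assms(2) v(2) by (auto simp: Digraph_Component.connected_def strongly_connected_def)
  then have "(v, x) \<in> (arcs_ends ?H)\<^sup>*" by (rule reachable_rtranclI)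
  then show "x \<in> S"
  proof (induction rule: rtrancl_induct)
    case (step y z)
    then have "(y, z) \<in> parcs \<Gamma> \<or> (z, y) \<in> parcs \<Gamma>" by (auto simp: parcs_mk_symmetric)
    then show ?case using closed[OF step.IH] arcs_symmetric by blast
  qed (rule v)
qed

lemma walk_edge:
  assumes "pair_graph \<Gamma>" "(u, v) \<in> parcs \<Gamma>"
  shows "[u, v] \<in> walks \<Gamma> 1 u v"
proof -
  interpret pair_graph \<Gamma> by fact
  show ?thesis
    using assms(2) arc_fst_in_verts[OF assms(2)] arc_snd_in_verts[OF assms(2)]
    by (simp add: walks_def vwalk_def)
qed

text \<open>\<open>tl q\<close> drops the copy of the meeting vertex \<open>x\<close> with which
  \<open>q\<close> starts.\<close>

lemma walk_join:
  assumes "pair_graph \<Gamma>"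
  shows "w \<in> walks \<Gamma> h u x \<Longrightarrow> q \<in> walks \<Gamma> l x v \<Longrightarrow> w @ tl q \<in> walks \<Gamma> (h + l) u v"
proof (induction h arbitrary: u w)
  case 0
  then have "w = [u]" "u = x" by (auto simp: walks_0 split: if_splits)
  moreover have "q = x # tl q" using 0 by (cases q) (auto simp: walks_def)
  ultimately show ?case using 0 by (metis append_Cons append_Nil add_0)
next
  case (Suc h)
  then obtain y w' where w: "(u, y) \<in> parcs \<Gamma>" "w' \<in> walks \<Gamma> h y x" "w = u # w'"
    unfolding walks_Suc[OF assms] by auto
  then have "w' @ tl q \<in> walks \<Gamma> (h + l) y v" using Suc by blast
  then show ?case using w by (auto simp: walks_Suc[OF assms])
qed

lemma walk_gain_join:
  assumes "group G" "pair_graph \<Gamma>" and gain: "\<And>e. e \<in> parcs \<Gamma> \<Longrightarrow> \<Psi> e \<in> carrier G"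
  shows "w \<in> walks \<Gamma> h u x \<Longrightarrow> q \<in> walks \<Gamma> l x v \<Longrightarrow>
    walk_gain G \<Psi> (w @ tl q) = walk_gain G \<Psi> w \<otimes>\<^bsub>G\<^esub> walk_gain G \<Psi> q"
proof (induction h arbitrary: u w)
  case 0
  interpret group G by fact
  have "w = [u]" "u = x" using 0 by (auto simp: walks_0 split: if_splits)
  moreover have "q = x # tl q" using 0 by (cases q) (auto simp: walks_def)
  moreover have "walk_gain G \<Psi> q \<in> carrier G"
    using 0 by (intro walk_gain_closed[OF assms(1) gain]) (auto simp: walks_def)
  ultimately show ?case by (metis append_Cons append_Nil l_one walk_gain_singleton)
next
  case (Suc h)
  interpret group G by fact
  obtain y w' where w: "(u, y) \<in> parcs \<Gamma>" "w' \<in> walks \<Gamma> h y x" "w = u # w'"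
    using Suc.prems unfolding walks_Suc[OF assms(2)] by auto
  then have w': "w' \<noteq> []" "hd w' = y" by (auto simp: walks_def)
  have c: "walk_gain G \<Psi> q \<in> carrier G" "walk_gain G \<Psi> w' \<in> carrier G" "\<Psi> (u, y) \<in> carrier G"
    using Suc.prems w gain walk_gain_closed[OF assms(1) gain] by (auto simp: walks_def)
  show ?case
    using Suc.IH[OF w(2) Suc.prems(2)] w(3) w' c by (simp add: walk_gain_Cons m_assoc)
qed

text \<open>Each edge changes sides, so a walk ends on its starting side exactly when its length is
  even. This settles the odd exponents in the bipartite case of the trace condition, which speaks of
  even powers only.\<close>

lemma bipartite_closed_walks_odd:
  assumes "pair_graph \<Gamma>" "bipartite \<Gamma>" "odd h"
  shows "closed_walks \<Gamma> h = {}"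
proof -
  obtain X Y where "X \<inter> Y = {}"
    "\<forall>(u, v)\<in>parcs \<Gamma>. (u \<in> X \<and> v \<in> Y) \<or> (u \<in> Y \<and> v \<in> X)"
    using assms(2) unfolding bipartite_def by blast
  then have edge: "v \<in> X \<longleftrightarrow> u \<notin> X" if "(u, v) \<in> parcs \<Gamma>" for u v
    using that by fast
  have alt: "(u \<in> X \<longleftrightarrow> v \<in> X) = even h" if "w \<in> walks \<Gamma> h u v" for w u v h
    using that
  proof (induction h arbitrary: u w)
    case 0
    then show ?case by (simp add: walks_0 split: if_splits)
  next
    case (Suc h)
    then obtain y w' where y: "(u, y) \<in> parcs \<Gamma>" "w' \<in> walks \<Gamma> h y v"
      unfolding walks_Suc[OF assms(1)] by auto
    show ?case using Suc.IH[OF y(2)] edge[OF y(1)] by auto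
  qed
  show ?thesis
    using alt assms(3) by (force simp: closed_walks_def walks_def)
qed

lemma balanced_iff_closed_walks:
  "balanced G \<Gamma> \<Psi> \<longleftrightarrow> (\<forall>h. \<forall>w\<in>closed_walks \<Gamma> h. walk_gain G \<Psi> w = \<one>\<^bsub>G\<^esub>)"
proof -
  have "\<exists>h. length w = Suc h" if "vwalk w (with_proj \<Gamma>)" for w
    using that by (cases w) (auto simp: vwalk_def)
  then show ?thesis unfolding balanced_def closed_walks_def by blast
qed

lemma sum_mset_repeat_mset:
  fixes f :: "'a \<Rightarrow> 'b :: comm_semiring_1"
  shows "(\<Sum>x\<in>#repeat_mset k M. f x) = of_nat k * (\<Sum>x\<in>#M. f x)"
proof (induction k)
  case (Suc k)
  have "repeat_mset (Suc k) M = M + repeat_mset k M" by (rule multiset_eqI) simp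
  then have "(\<Sum>x\<in>#repeat_mset (Suc k) M. f x) = (\<Sum>x\<in>#M. f x) + of_nat k * (\<Sum>x\<in>#M. f x)"
    by (simp only: image_mset_union sum_mset.union Suc)
  then show ?case by (simp only: of_nat_Suc distrib_right mult_1_left)
qed simp

lemma (in group) conj_eq_one_imp:
  assumes "a \<in> carrier G" "x \<in> carrier G" "a \<otimes> x \<otimes> inv a = \<one>"
  shows "x = \<one>"
proof -
  have "a \<otimes> x = a" using assms inv_equality[of "a \<otimes> x" "inv a"] by simp
  then show ?thesis using assms by (simp add: l_cancel_one)
qed

section \<open>Balance and the defect\<close>

context represented_gain_graph
begin

abbreviation "A \<equiv> adjacency_mat \<Gamma> vs"

abbreviation "N h \<equiv> card (closed_walks \<Gamma> h)"

lemma A_carrier: "A \<in> carrier_mat n n"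
  by (simp add: adjacency_mat_def)

text \<open>\<open>A\<close> is the represented matrix of the trivial representation of degree 1,
  under which each closed walk contributes 1.\<close>

lemma trace_A_pow: "mat_trace (A ^\<^sub>m h) = of_nat (N h)"
proof -
  interpret one: represented_gain_graph G 1 "\<lambda>_. 1\<^sub>m 1" \<Gamma> \<Psi> vs
  proof (intro represented_gain_graph.intro group graph vs gain)
    show "unitary_representation G 1 (\<lambda>_. 1\<^sub>m 1)"
      by (simp add: unitary_representation_def hom_def unitary_group_def unitary_mat_def mat_adjoint_one)
  qed
  have "A = rep_adjacency_mat 1 (\<lambda>_. 1\<^sub>m 1) \<Gamma> \<Psi> vs"
    by (rule eq_matI) (auto simp: adjacency_mat_def rep_adjacency_mat_def Let_def)
  moreover have "mat_trace (1\<^sub>m 1) = 1" by (simp add: mat_trace_def)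
  ultimately show ?thesis using one.trace_A\<pi>_pow[of h] by simp
qed

lemma mat_trace_one: "mat_trace (1\<^sub>m k) = of_nat k"
  by (simp add: mat_trace_def)

lemma trace_abs_pow: "mat_trace (abs_rep_adjacency_mat G k \<pi> \<Gamma> vs ^\<^sub>m h) = of_nat (k * N h)"
proof -
  interpret monoid G using group by (rule group.is_monoid)
  interpret triv: represented_gain_graph G k \<pi> \<Gamma> "\<lambda>_. \<one>\<^bsub>G\<^esub>" vs
    by (intro represented_gain_graph.intro group rep graph vs one_closed)
  have gain_one: "walk_gain G (\<lambda>_. \<one>\<^bsub>G\<^esub>) w = \<one>\<^bsub>G\<^esub>" for w :: "'v list"
  proof -
    have "foldr (\<lambda>e x. \<one>\<^bsub>G\<^esub> \<otimes>\<^bsub>G\<^esub> x) es \<one>\<^bsub>G\<^esub> = \<one>\<^bsub>G\<^esub>" for es :: "('v \<times> 'v) list"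
      by (induction es) auto
    then show ?thesis by (simp add: walk_gain_def)
  qed
  then show ?thesis
    using triv.trace_A\<pi>_pow[of h]
    by (simp add: abs_rep_adjacency_mat_def \<pi>_one mat_trace_one)
qed

lemma norm_trace_A\<pi>_le: "norm (mat_trace (A\<pi> ^\<^sub>m h)) \<le> real k * real (N h)"
proof -
  have "norm (mat_trace (A\<pi> ^\<^sub>m h)) \<le> (\<Sum>w\<in>closed_walks \<Gamma> h. real k)"
    unfolding trace_A\<pi>_pow
    by (intro order_trans[OF norm_sum] sum_mono unitary_mat_norm_trace_le \<pi>_unitary gain_walks)
  then show ?thesis by (simp add: mult.commute)
qed

lemma vs_in_pverts: "i < n \<Longrightarrow> vs ! i \<in> pverts \<Gamma>"
  using vs(2) nth_mem by blast

text \<open>Simplicity comes from Perron-Frobenius; connectedness of \<open>\<Gamma>\<close> is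
  irreducibility, carried over to indices by the enumeration \<open>vs\<close>.\<close>

lemma count_A_spectral_radius:
  assumes con: "Digraph_Component.connected (with_proj \<Gamma>)"
  shows "count (mspectrum A) (of_real (spectral_radius A)) = 1"
proof -
  interpret \<Gamma>: pair_graph \<Gamma> by (rule graph)
  define a :: "nat \<Rightarrow> nat \<Rightarrow> real" where
    "a i j = (if i < n \<and> j < n \<and> (vs ! i, vs ! j) \<in> parcs \<Gamma> then 1 else 0)" for i j
  have "pverts \<Gamma> \<noteq> {}"
    using con by (auto simp: Digraph_Component.connected_def strongly_connected_def)
  then have n: "n > 0" using vs(2) by auto
  interpret irreducible_symmetric_mat n A a
  proof
    show "A \<in> carrier_mat n n" "n > 0" by (fact A_carrier, fact n)
    show "A $$ (i, j) = of_real (a i j)" if "i < n" "j < n" for i j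
      using that by (simp add: a_def adjacency_mat_def)
    show "a i j = a j i" for i j using \<Gamma>.arcs_symmetric by (auto simp: a_def)
    show "a i j \<ge> 0" for i j by (simp add: a_def)
    fix i and S :: "nat set"
    assume i: "i \<in> S" "i < n"
      and closed: "\<And>i j. i \<in> S \<Longrightarrow> i < n \<Longrightarrow> j < n \<Longrightarrow> a i j \<noteq> 0 \<Longrightarrow> j \<in> S"
    \<comment> \<open>The index set becomes a vertex set, cut down to the indices below
      \<open>n\<close> because \<open>vs ! i\<close> carries no meaning beyond; distinctness of
      \<open>vs\<close> leads back.\<close>
    have "pverts \<Gamma> \<subseteq> (!) vs ` (S \<inter> {..<n})"
    proof (rule connected_closed_under_adjacency[OF graph con])
      show "vs ! i \<in> (!) vs ` (S \<inter> {..<n})" "vs ! i \<in> pverts \<Gamma>"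
        using i vs_in_pverts by auto
    next
      fix u x assume "u \<in> (!) vs ` (S \<inter> {..<n})" and e: "(u, x) \<in> parcs \<Gamma>"
      then obtain i where i: "i \<in> S" "i < n" "u = vs ! i" by auto
      have "x \<in> set vs" using \<Gamma>.arc_snd_in_verts[OF e] vs(2) by simp
      then obtain j where j: "j < n" "x = vs ! j" by (metis in_set_conv_nth)
      then have "j \<in> S" using closed[OF i(1,2) j(1)] e i j by (simp add: a_def)
      then show "x \<in> (!) vs ` (S \<inter> {..<n})" using j by auto
    qed
    then have all: "vs ! j \<in> (!) vs ` (S \<inter> {..<n})" if "j < n" for j
      using vs_in_pverts[OF that] by blast
    show "{..<n} \<subseteq> S"
    proof
      fix j assume "j \<in> {..<n}"
      then obtain i where "i \<in> S" "i < n" "vs ! j = vs ! i" "j < n" using all[of j] by auto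
      then show "j \<in> S" using nth_eq_iff_index_eq[OF vs(1)] by simp
    qed
  qed
  show ?thesis by (rule count_spectral_radius)
qed

definition defect :: "nat \<Rightarrow> real" where
  "defect h = real (k * N h) - Re (mat_trace (A\<pi> ^\<^sub>m h))"

lemma defect_eq_sum:
  "defect h = (\<Sum>w\<in>closed_walks \<Gamma> h. k - Re (mat_trace (\<pi> (walk_gain G \<Psi> w))))"
  by (simp add: defect_def trace_A\<pi>_pow sum_subtractf mult.commute)

lemma Re_trace_\<pi>_le: "x \<in> carrier G \<Longrightarrow> Re (mat_trace (\<pi> x)) \<le> k"
  using unitary_mat_norm_trace_le[OF \<pi>_unitary] complex_Re_le_cmod by (blast intro: order_trans)

text \<open>This is where faithfulness enters: a full trace puts \<open>x\<close> into the kernel of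
  \<open>\<pi>\<close>.\<close>

lemma Re_trace_\<pi>_eq_iff:
  assumes faithful: "faithful_representation G k \<pi>" and x: "x \<in> carrier G"
  shows "Re (mat_trace (\<pi> x)) = k \<longleftrightarrow> x = \<one>\<^bsub>G\<^esub>"
proof
  assume "Re (mat_trace (\<pi> x)) = k"
  then have "\<pi> x = 1\<^sub>m k" by (rule unitary_mat_Re_trace_eq_imp_one[OF \<pi>_unitary[OF x]])
  then have "x \<in> kernel G (unitary_group k) \<pi>"
    using x by (simp add: kernel_def unitary_group_def)
  then show "x = \<one>\<^bsub>G\<^esub>" using faithful by (simp add: faithful_representation_def)
qed (simp add: \<pi>_one mat_trace_one)

text \<open>\<open>defect h\<close> is a sum of nonnegative terms, one for each closed walk, and a
  term vanishes only for trivial gain.\<close>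

lemma defect_eq_0_iff:
  assumes "faithful_representation G k \<pi>"
  shows "defect h = 0 \<longleftrightarrow> (\<forall>w\<in>closed_walks \<Gamma> h. walk_gain G \<Psi> w = \<one>\<^bsub>G\<^esub>)"
proof -
  have "defect h = 0 \<longleftrightarrow>
    (\<forall>w\<in>closed_walks \<Gamma> h. k - Re (mat_trace (\<pi> (walk_gain G \<Psi> w))) = 0)"
    unfolding defect_eq_sum using Re_trace_\<pi>_le[OF gain_walks(2)] finite_walks(2)[OF graph]
    by (intro sum_nonneg_eq_0_iff) auto
  also have "\<dots> \<longleftrightarrow> (\<forall>w\<in>closed_walks \<Gamma> h. walk_gain G \<Psi> w = \<one>\<^bsub>G\<^esub>)"
  proof (rule ball_cong[OF refl])
    fix w assume w: "w \<in> closed_walks \<Gamma> h"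
    show "k - Re (mat_trace (\<pi> (walk_gain G \<Psi> w))) = 0 \<longleftrightarrow> walk_gain G \<Psi> w = \<one>\<^bsub>G\<^esub>"
      using Re_trace_\<pi>_eq_iff[OF assms gain_walks(2)[OF w]] by auto
  qed
  finally show ?thesis .
qed

lemma trace_A\<pi>_eq_if_balanced:
  assumes "balanced G \<Gamma> \<Psi>"
  shows "mat_trace (A\<pi> ^\<^sub>m h) = of_nat (k * N h)"
proof -
  have "mat_trace (A\<pi> ^\<^sub>m h) = (\<Sum>w\<in>closed_walks \<Gamma> h. of_nat k)"
    unfolding trace_A\<pi>_pow using assms
    by (intro sum.cong) (simp_all add: balanced_iff_closed_walks \<pi>_one mat_trace_one)
  then show ?thesis by (simp add: mult.commute)
qed

lemma balanced_iff_mspectrum: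
  assumes faithful: "faithful_representation G k \<pi>"
  shows "balanced G \<Gamma> \<Psi> \<longleftrightarrow> mspectrum A\<pi> = repeat_mset k (mspectrum A)"
proof
  assume bal: "balanced G \<Gamma> \<Psi>"
  show "mspectrum A\<pi> = repeat_mset k (mspectrum A)"
    by (rule multiset_eq_if_power_sums_eq)
       (simp add: sum_mset_repeat_mset trace_A\<pi>_eq_if_balanced[OF bal] trace_A_pow
         flip: mat_trace_pow[OF A\<pi>_carrier] mat_trace_pow[OF A_carrier])
next
  assume eq: "mspectrum A\<pi> = repeat_mset k (mspectrum A)"
  have "mat_trace (A\<pi> ^\<^sub>m h) = of_nat k * mat_trace (A ^\<^sub>m h)" for h
    unfolding mat_trace_pow[OF A\<pi>_carrier] mat_trace_pow[OF A_carrier] eq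
    by (rule sum_mset_repeat_mset)
  then have "defect h = 0" for h by (simp add: defect_def trace_A_pow)
  then show "balanced G \<Gamma> \<Psi>"
    using defect_eq_0_iff[OF faithful] by (simp add: balanced_iff_closed_walks)
qed

section \<open>Real Cesaro means at the spectral radius\<close>

abbreviation "\<rho> \<equiv> spectral_radius A"

text \<open>The real counterpart of \<open>cesaro_mean\<close> at \<open>\<rho>\<close>, for which
  means can be compared by order.\<close>

definition mean :: "(nat \<Rightarrow> real) \<Rightarrow> nat \<Rightarrow> real" where
  "mean f H = (\<Sum>h<H. f h / \<rho> ^ h) / real H"

lemma mean_eq: "mean (\<lambda>h. Re (f h)) H = Re (cesaro_mean (of_real \<rho>) f H)"
proof -
  have "Re (f h / of_real \<rho> ^ h) = Re (f h) / \<rho> ^ h" for h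
    by (metis Re_divide_of_real of_real_power)
  then show ?thesis
    by (simp add: mean_def cesaro_mean_def Re_divide_of_nat)
qed

lemma mean_mono: "\<rho> \<ge> 0 \<Longrightarrow> (\<And>h. f h \<le> g h) \<Longrightarrow> mean f H \<le> mean g H"
  unfolding mean_def by (intro divide_right_mono sum_mono) auto

lemma mean_add: "mean (\<lambda>h. f h + g h) H = mean f H + mean g H"
  by (simp add: mean_def sum.distrib add_divide_distrib)

lemma mean_cmult: "mean (\<lambda>h. c * f h) H = c * mean f H"
  by (simp add: mean_def sum_distrib_left)

lemma mean_sum: "mean (\<lambda>h. \<Sum>v\<in>S. f v h) H = (\<Sum>v\<in>S. mean (f v) H)"
  unfolding mean_def sum_divide_distrib by (rule sum.swap)

lemma mean_N:
  assumes con: "Digraph_Component.connected (with_proj \<Gamma>)" and \<rho>: "\<rho> > 0"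
  shows "mean (\<lambda>h. real (N (h + L))) \<longlonglongrightarrow> \<rho> ^ L"
proof -
  have "cesaro_mean (of_real \<rho>) (\<lambda>h. mat_trace (A ^\<^sub>m (h + L)))
    \<longlonglongrightarrow> of_real \<rho> ^ L * of_nat (count (mspectrum A) (of_real \<rho>))"
    using \<rho> norm_le_spectral_radius[OF A_carrier] by (intro cesaro_mean_trace[OF A_carrier]) auto
  then have "(\<lambda>H. Re (cesaro_mean (of_real \<rho>) (\<lambda>h. mat_trace (A ^\<^sub>m (h + L))) H))
    \<longlonglongrightarrow> Re (of_real \<rho> ^ L * of_nat (count (mspectrum A) (of_real \<rho>)))"
    by (rule tendsto_Re)
  then show ?thesis
    by (simp add: count_A_spectral_radius[OF con] trace_A_pow flip: mean_eq of_real_power)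
qed

lemma mean_defect:
  assumes con: "Digraph_Component.connected (with_proj \<Gamma>)" and \<rho>: "\<rho> > 0"
  shows "mean (\<lambda>h. defect (h + L)) \<longlonglongrightarrow> \<rho> ^ L * (real k - count (mspectrum A\<pi>) (of_real \<rho>))"
proof -
  have n: "n > 0"
    using con vs(2) by (auto simp: Digraph_Component.connected_def strongly_connected_def)
  \<comment> \<open>The traces of powers of \<open>A\<pi>\<close> are dominated by \<open>k\<close>
    times those of \<open>A\<close>, which keeps its eigenvalues within the disc of radius
    \<open>\<rho>\<close>, as the Cesaro limit requires.\<close>
  have "norm x \<le> \<rho>" if "x \<in># mspectrum A\<pi>" for x
    by (rule norm_le_spectral_radius_if_trace_le[OF A_carrier n A\<pi>_carrier _ _ that,
          where t = "\<lambda>h. real (N h)" and c = "real k"])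
       (simp_all add: trace_A_pow norm_trace_A\<pi>_le)
  then have "cesaro_mean (of_real \<rho>) (\<lambda>h. mat_trace (A\<pi> ^\<^sub>m (h + L)))
    \<longlonglongrightarrow> of_real \<rho> ^ L * of_nat (count (mspectrum A\<pi>) (of_real \<rho>))"
    using \<rho> by (intro cesaro_mean_trace[OF A\<pi>_carrier]) auto
  then have "(\<lambda>H. Re (cesaro_mean (of_real \<rho>) (\<lambda>h. mat_trace (A\<pi> ^\<^sub>m (h + L))) H))
    \<longlonglongrightarrow> Re (of_real \<rho> ^ L * of_nat (count (mspectrum A\<pi>) (of_real \<rho>)))"
    by (rule tendsto_Re)
  then have "mean (\<lambda>h. Re (mat_trace (A\<pi> ^\<^sub>m (h + L))))
    \<longlonglongrightarrow> \<rho> ^ L * count (mspectrum A\<pi>) (of_real \<rho>)"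
    by (simp flip: mean_eq of_real_power)
  then have "(\<lambda>H. k * mean (\<lambda>h. real (N (h + L))) H + (- 1) * mean (\<lambda>h. Re (mat_trace (A\<pi> ^\<^sub>m (h + L)))) H)
    \<longlonglongrightarrow> k * \<rho> ^ L + (- 1) * (\<rho> ^ L * count (mspectrum A\<pi>) (of_real \<rho>))"
    by (intro tendsto_add tendsto_mult tendsto_const mean_N[OF con \<rho>])
  moreover have "(\<lambda>H. k * mean (\<lambda>h. real (N (h + L))) H
    + (- 1) * mean (\<lambda>h. Re (mat_trace (A\<pi> ^\<^sub>m (h + L)))) H) = mean (\<lambda>h. defect (h + L))"
    unfolding mean_cmult[symmetric] mean_add[symmetric] by (simp add: defect_def)
  ultimately have "mean (\<lambda>h. defect (h + L))
    \<longlonglongrightarrow> k * \<rho> ^ L + (- 1) * (\<rho> ^ L * count (mspectrum A\<pi>) (of_real \<rho>))"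
    by (simp only:)
  then show ?thesis by (simp add: algebra_simps)
qed

end

section \<open>Finite groups and connected graphs\<close>

locale finite_connected_gain_graph = represented_gain_graph +
  assumes faithful: "faithful_representation G k \<pi>"
    and gain_function: "gain_function G \<Gamma> \<Psi>"
    and finite_group: "finite (carrier G)"
    and con: "Digraph_Component.connected (with_proj \<Gamma>)"
begin

text \<open>Nontrivial gain moves from \<open>u\<close> to a neighbour \<open>x\<close> by walking
  from \<open>x\<close> to \<open>u\<close>, around the closed walk, and back: the gain is
  conjugated by \<open>\<Psi> (x, u)\<close>, and a conjugate of a nontrivial element is
  nontrivial.\<close>

lemma unbalanced_at_every_vertex:
  assumes "\<not> balanced G \<Gamma> \<Psi>" and "v \<in> pverts \<Gamma>"
  shows "\<exists>L. \<exists>q\<in>walks \<Gamma> L v v. walk_gain G \<Psi> q \<noteq> \<one>\<^bsub>G\<^esub>"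
proof -
  interpret group G by (rule group)
  interpret \<Gamma>: pair_graph \<Gamma> by (rule graph)
  define S where "S = {v. \<exists>L. \<exists>q\<in>walks \<Gamma> L v v. walk_gain G \<Psi> q \<noteq> \<one>\<^bsub>G\<^esub>}"
  obtain h w where w: "w \<in> closed_walks \<Gamma> h" "walk_gain G \<Psi> w \<noteq> \<one>\<^bsub>G\<^esub>"
    using assms(1) by (auto simp: balanced_iff_closed_walks)
  have "pverts \<Gamma> \<subseteq> S"
  proof (rule connected_closed_under_adjacency[OF graph con])
    have "w \<in> walks \<Gamma> h (hd w) (hd w)"
      using w(1) by (simp add: walks_def closed_walks_def)
    then show "hd w \<in> S" using w(2) by (auto simp: S_def)
    show "hd w \<in> pverts \<Gamma>"
      using w(1) hd_in_set[of w] by (auto simp: closed_walks_def vwalk_def)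
  next
    fix u x assume u: "u \<in> S" and e: "(u, x) \<in> parcs \<Gamma>"
    obtain L q where q: "q \<in> walks \<Gamma> L u u" "walk_gain G \<Psi> q \<noteq> \<one>\<^bsub>G\<^esub>"
      using u by (auto simp: S_def)
    have e': "(x, u) \<in> parcs \<Gamma>" using e by (rule \<Gamma>.arcs_symmetric)
    have inv: "\<Psi> (u, x) = inv\<^bsub>G\<^esub> \<Psi> (x, u)"
      using gain_function e by (auto simp: gain_function_def)
    note c = gain[OF e] gain[OF e'] gain_walks(1)[OF q(1)]
    note join = walk_join[OF graph walk_edge[OF graph e'] q(1)]
    have edge: "walk_gain G \<Psi> [y, z] = \<Psi> (y, z)" if "\<Psi> (y, z) \<in> carrier G" for y z
      using that by (simp add: walk_gain_Cons walk_gain_singleton)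
    have "walk_gain G \<Psi> (([x, u] @ tl q) @ tl [u, x]) =
      walk_gain G \<Psi> ([x, u] @ tl q) \<otimes>\<^bsub>G\<^esub> walk_gain G \<Psi> [u, x]"
      by (rule walk_gain_join[OF group graph gain join walk_edge[OF graph e]])
    also have "walk_gain G \<Psi> ([x, u] @ tl q) = walk_gain G \<Psi> [x, u] \<otimes>\<^bsub>G\<^esub> walk_gain G \<Psi> q"
      by (rule walk_gain_join[OF group graph gain walk_edge[OF graph e'] q(1)])
    finally have "walk_gain G \<Psi> (([x, u] @ tl q) @ tl [u, x]) =
      \<Psi> (x, u) \<otimes>\<^bsub>G\<^esub> walk_gain G \<Psi> q \<otimes>\<^bsub>G\<^esub> inv\<^bsub>G\<^esub> \<Psi> (x, u)"
      unfolding edge[OF c(1)] edge[OF c(2)] by (simp only: inv)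
    then have "walk_gain G \<Psi> (([x, u] @ tl q) @ tl [u, x]) \<noteq> \<one>\<^bsub>G\<^esub>"
      using conj_eq_one_imp[OF c(2,3)] q(2) by auto
    then show "x \<in> S"
      using walk_join[OF graph join walk_edge[OF graph e]] unfolding S_def by blast
  qed
  then show ?thesis using assms(2) by (auto simp: S_def)
qed

definition
  "unbalanced_walks h = {w \<in> closed_walks \<Gamma> h. walk_gain G \<Psi> w \<noteq> \<one>\<^bsub>G\<^esub>}"

text \<open>A closed walk with trivial gain at \<open>v\<close> becomes one with nontrivial gain
  when followed by a fixed closed walk with nontrivial gain at \<open>v\<close>.\<close>

lemma card_closed_walks_le:
  assumes L: "\<And>v. v \<in> pverts \<Gamma> \<Longrightarrow> \<exists>q\<in>walks \<Gamma> (L v) v v. walk_gain G \<Psi> q \<noteq> \<one>\<^bsub>G\<^esub>"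
  shows "N h \<le> card (unbalanced_walks h) + (\<Sum>v\<in>pverts \<Gamma>. card (unbalanced_walks (h + L v)))"
proof -
  interpret group G by (rule group)
  interpret \<Gamma>: pair_graph \<Gamma> by (rule graph)
  define good where "good v = {w \<in> walks \<Gamma> h v v. walk_gain G \<Psi> w = \<one>\<^bsub>G\<^esub>}" for v
  have fin: "finite (unbalanced_walks h)" "finite (good v)" for h v
    using finite_walks[OF graph] by (auto simp: unbalanced_walks_def good_def)
  have good_le: "card (good v) \<le> card (unbalanced_walks (h + L v))" if v: "v \<in> pverts \<Gamma>" for v
  proof -
    obtain q where q: "q \<in> walks \<Gamma> (L v) v v" "walk_gain G \<Psi> q \<noteq> \<one>\<^bsub>G\<^esub>" using L[OF v] by blast
    have "(\<lambda>w. w @ tl q) ` good v \<subseteq> unbalanced_walks (h + L v)"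
    proof
      fix w' assume "w' \<in> (\<lambda>w. w @ tl q) ` good v"
      then obtain w where w: "w \<in> walks \<Gamma> h v v" "walk_gain G \<Psi> w = \<one>\<^bsub>G\<^esub>" "w' = w @ tl q"
        by (auto simp: good_def)
      have "walk_gain G \<Psi> w' = walk_gain G \<Psi> q"
        using walk_gain_join[OF group graph gain w(1) q(1)] w gain_walks(1)[OF q(1)] by simp
      moreover have "w' \<in> closed_walks \<Gamma> (h + L v)"
        using walk_join[OF graph w(1) q(1)] w(3) by (simp add: walks_def closed_walks_def)
      ultimately show "w' \<in> unbalanced_walks (h + L v)" using q(2) by (simp add: unbalanced_walks_def)
    qed
    moreover have "inj_on (\<lambda>w. w @ tl q) (good v)" by (simp add: inj_on_def)
    ultimately show ?thesis using card_inj_on_le fin by blast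
  qed
  have "closed_walks \<Gamma> h \<subseteq> unbalanced_walks h \<union> (\<Union>v\<in>pverts \<Gamma>. good v)"
  proof
    fix w assume w: "w \<in> closed_walks \<Gamma> h"
    then have "hd w \<in> pverts \<Gamma>" using hd_in_set[of w] by (auto simp: closed_walks_def vwalk_def)
    moreover have "w \<in> walks \<Gamma> h (hd w) (hd w)" using w by (simp add: walks_def closed_walks_def)
    ultimately show "w \<in> unbalanced_walks h \<union> (\<Union>v\<in>pverts \<Gamma>. good v)"
      using w by (auto simp: unbalanced_walks_def good_def)
  qed
  then have "N h \<le> card (unbalanced_walks h \<union> (\<Union>v\<in>pverts \<Gamma>. good v))"
    using fin \<Gamma>.pair_finite_verts by (intro card_mono) auto
  also have "\<dots> \<le> card (unbalanced_walks h) + card (\<Union>v\<in>pverts \<Gamma>. good v)" by (rule card_Un_le)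
  also have "card (\<Union>v\<in>pverts \<Gamma>. good v) \<le> (\<Sum>v\<in>pverts \<Gamma>. card (good v))"
    by (rule card_UN_le[OF \<Gamma>.pair_finite_verts])
  also have "\<dots> \<le> (\<Sum>v\<in>pverts \<Gamma>. card (unbalanced_walks (h + L v)))" by (intro sum_mono good_le)
  finally show ?thesis by simp
qed

text \<open>A closed walk of positive length \<open>h\<close> makes the trace of
  \<open>A ^ h\<close> positive, while \<open>\<rho> = 0\<close> would make it vanish.\<close>

lemma spectral_radius_pos:
  assumes "closed_walks \<Gamma> h \<noteq> {}" "h > 0"
  shows "\<rho> > 0"
proof -
  have n: "n > 0"
    using con vs(2) by (auto simp: Digraph_Component.connected_def strongly_connected_def)
  have "real (N h) \<le> n * \<rho> ^ h"
    using norm_trace_pow_le[OF A_carrier, of h] by (simp add: trace_A_pow)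
  moreover have "N h > 0" using assms finite_walks[OF graph] by (simp add: card_gt_0_iff)
  ultimately have "\<rho> \<noteq> 0" using assms(2) by (auto simp: zero_power)
  then show ?thesis using spectral_radius_nonneg[OF A_carrier n] by simp
qed

lemma spectral_radius_pos_if_unbalanced:
  assumes "\<not> balanced G \<Gamma> \<Psi>"
  shows "\<rho> > 0"
proof -
  obtain h w where w: "w \<in> closed_walks \<Gamma> h" "walk_gain G \<Psi> w \<noteq> \<one>\<^bsub>G\<^esub>"
    using assms by (auto simp: balanced_iff_closed_walks)
  have "h \<noteq> 0"
    using w by (auto simp: closed_walks_def length_Suc_conv walk_gain_singleton)
  then show ?thesis using spectral_radius_pos w(1) by blast
qed

text \<open>Each unbalanced walk costs at least \<open>\<delta>\<close> of defect. Averaging the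
  bound of \<open>card_closed_walks_le\<close> over \<open>h\<close> then gives, in the limit, that
  \<open>\<delta>\<close> is at most a positive multiple of the gap \<open>c\<close> between
  \<open>k\<close> and the multiplicity; so \<open>c\<close> is positive.\<close>

lemma count_less_if_unbalanced:
  assumes unb: "\<not> balanced G \<Gamma> \<Psi>"
  shows "count (mspectrum A\<pi>) (of_real \<rho>) < k"
proof -
  have \<rho>: "\<rho> > 0" by (rule spectral_radius_pos_if_unbalanced[OF unb])
  define E where "E = (\<lambda>x. k - Re (mat_trace (\<pi> x))) ` (carrier G - {\<one>\<^bsub>G\<^esub>})"
  obtain h w where w: "w \<in> closed_walks \<Gamma> h" "walk_gain G \<Psi> w \<noteq> \<one>\<^bsub>G\<^esub>"
    using unb by (auto simp: balanced_iff_closed_walks)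
  have E: "finite E" "E \<noteq> {}" using finite_group w gain_walks(2) by (auto simp: E_def)
  \<comment> \<open>The minimum exists because \<open>G\<close> is finite; in an infinite group the
    costs of nontrivial elements may approach 0.\<close>
  define \<delta> where "\<delta> = Min E"
  have \<delta>: "\<delta> > 0"
    unfolding \<delta>_def using Re_trace_\<pi>_le Re_trace_\<pi>_eq_iff[OF faithful]
    by (subst Min_gr_iff[OF E]) (force simp: E_def less_le)
  have bad_le: "\<delta> * card (unbalanced_walks h) \<le> defect h" for h
  proof -
    have "\<delta> * card (unbalanced_walks h) = (\<Sum>w\<in>unbalanced_walks h. \<delta>)" by (simp add: mult.commute)
    also have "\<dots> \<le> (\<Sum>w\<in>unbalanced_walks h. k - Re (mat_trace (\<pi> (walk_gain G \<Psi> w))))"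
      using gain_walks(2) E by (intro sum_mono) (auto simp: \<delta>_def E_def unbalanced_walks_def intro!: Min_le)
    also have "\<dots> \<le> defect h"
      unfolding defect_eq_sum using Re_trace_\<pi>_le[OF gain_walks(2)] finite_walks(2)[OF graph]
      by (intro sum_mono2) (auto simp: unbalanced_walks_def \<pi>_one mat_trace_one)
    finally show ?thesis .
  qed
  obtain L where L: "\<And>v. v \<in> pverts \<Gamma> \<Longrightarrow> \<exists>q\<in>walks \<Gamma> (L v) v v. walk_gain G \<Psi> q \<noteq> \<one>\<^bsub>G\<^esub>"
    using unbalanced_at_every_vertex[OF unb] by metis
  \<comment> \<open>The summand \<open>+ 0\<close> brings the unshifted terms into the form of
    \<open>mean_N\<close> and \<open>mean_defect\<close>.\<close>
  have le: "\<delta> * real (N (h + 0)) \<le> defect (h + 0) + (\<Sum>v\<in>pverts \<Gamma>. defect (h + L v))" for h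
  proof -
    have "\<delta> * real (N h) \<le> \<delta> * real (card (unbalanced_walks h) + (\<Sum>v\<in>pverts \<Gamma>. card (unbalanced_walks (h + L v))))"
      using \<delta> by (intro mult_left_mono of_nat_mono card_closed_walks_le[OF L]) simp_all
    also have "\<dots> = \<delta> * card (unbalanced_walks h) + (\<Sum>v\<in>pverts \<Gamma>. \<delta> * card (unbalanced_walks (h + L v)))"
      by (simp add: algebra_simps sum_distrib_left)
    also have "\<dots> \<le> defect h + (\<Sum>v\<in>pverts \<Gamma>. defect (h + L v))"
      by (intro add_mono sum_mono bad_le)
    finally show ?thesis by simp
  qed
  define c where "c = real k - count (mspectrum A\<pi>) (of_real \<rho>)"
  have "\<delta> * \<rho> ^ 0 \<le> \<rho> ^ 0 * c + (\<Sum>v\<in>pverts \<Gamma>. \<rho> ^ L v * c)"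
  proof (rule LIMSEQ_le)
    show "(\<lambda>H. \<delta> * mean (\<lambda>h. real (N (h + 0))) H) \<longlonglongrightarrow> \<delta> * \<rho> ^ 0"
      by (intro tendsto_mult tendsto_const mean_N[OF con \<rho>])
    show "(\<lambda>H. mean (\<lambda>h. defect (h + 0)) H + (\<Sum>v\<in>pverts \<Gamma>. mean (\<lambda>h. defect (h + L v)) H))
      \<longlonglongrightarrow> \<rho> ^ 0 * c + (\<Sum>v\<in>pverts \<Gamma>. \<rho> ^ L v * c)"
      unfolding c_def by (intro tendsto_add tendsto_sum mean_defect[OF con \<rho>])
    show "\<exists>M. \<forall>H\<ge>M. \<delta> * mean (\<lambda>h. real (N (h + 0))) H
      \<le> mean (\<lambda>h. defect (h + 0)) H + (\<Sum>v\<in>pverts \<Gamma>. mean (\<lambda>h. defect (h + L v)) H)"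
      unfolding mean_cmult[symmetric] mean_sum[symmetric] mean_add[symmetric]
      using le \<rho> by (intro exI allI impI mean_mono) auto
  qed
  then have "\<delta> \<le> c * (1 + (\<Sum>v\<in>pverts \<Gamma>. \<rho> ^ L v))"
    by (simp add: algebra_simps sum_distrib_left)
  moreover have "1 + (\<Sum>v\<in>pverts \<Gamma>. \<rho> ^ L v) > 0"
    using \<rho> by (intro add_pos_nonneg sum_nonneg) auto
  ultimately have "c > 0" using \<delta> by (smt (verit) mult_nonpos_nonneg)
  then show ?thesis by (simp add: c_def)
qed

text \<open>If balanced, \<open>k\<close> copies of the simple eigenvalue \<open>\<rho>\<close> of
  \<open>A\<close> give multiplicity \<open>k\<close>; if not, the multiplicity is strictly
  smaller.\<close>

lemma balanced_iff_count:
  "balanced G \<Gamma> \<Psi> \<longleftrightarrow> count (mspectrum A\<pi>) (of_real \<rho>) = k"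
  using count_less_if_unbalanced balanced_iff_mspectrum[OF faithful] count_A_spectral_radius[OF con]
  by (metis count_repeat_mset less_irrefl mult.right_neutral)

text \<open>Means of the defect converge to the gap \<open>c\<close> up to a power of
  \<open>\<rho>\<close>, so smallness gives \<open>c \<le> \<epsilon> * k\<close> for every positive
  \<open>\<epsilon>\<close>; without balance \<open>c\<close> would be a positive integer.\<close>

lemma balanced_if_defect_small:
  assumes small: "\<And>\<epsilon>. \<epsilon> > 0 \<Longrightarrow> \<exists>M. \<forall>h\<ge>M. defect h \<le> \<epsilon> * real (k * N h)"
  shows "balanced G \<Gamma> \<Psi>"
proof (rule ccontr)
  assume unb: "\<not> balanced G \<Gamma> \<Psi>"
  have \<rho>: "\<rho> > 0" by (rule spectral_radius_pos_if_unbalanced[OF unb])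
  define c where "c = real k - count (mspectrum A\<pi>) (of_real \<rho>)"
  have "c \<le> \<epsilon> * k" if pos: "\<epsilon> > 0" for \<epsilon> :: real
  proof -
    obtain M where M: "\<And>h. h \<ge> M \<Longrightarrow> defect h \<le> (\<epsilon> * k) * real (N h)"
      using small[OF pos] by (auto simp: mult.assoc)
    \<comment> \<open>Shifting by \<open>M\<close> discards the initial indices, where the bound may
      fail; the factor \<open>\<rho> ^ M\<close> cancels afterwards.\<close>
    have "\<rho> ^ M * c \<le> (\<epsilon> * k) * \<rho> ^ M"
    proof (rule LIMSEQ_le)
      show "mean (\<lambda>h. defect (h + M)) \<longlonglongrightarrow> \<rho> ^ M * c"
        unfolding c_def by (rule mean_defect[OF con \<rho>])
      show "(\<lambda>H. (\<epsilon> * k) * mean (\<lambda>h. real (N (h + M))) H) \<longlonglongrightarrow> (\<epsilon> * k) * \<rho> ^ M"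
        by (intro tendsto_mult tendsto_const mean_N[OF con \<rho>])
      show "\<exists>m. \<forall>H\<ge>m. mean (\<lambda>h. defect (h + M)) H \<le> (\<epsilon> * k) * mean (\<lambda>h. real (N (h + M))) H"
        unfolding mean_cmult[symmetric] using M \<rho> by (intro exI allI impI mean_mono) auto
    qed
    then have "\<rho> ^ M * c \<le> \<rho> ^ M * (\<epsilon> * k)" by (simp add: mult.commute)
    then show ?thesis using \<rho> by simp
  qed
  \<comment> \<open>With this \<open>\<epsilon>\<close> the bound on \<open>c\<close> is
    \<open>k / (1 + k)\<close>, which is below 1.\<close>
  from this[of "1 / (1 + real k)"] have le: "c * (1 + real k) \<le> real k"
    by (simp add: divide_simps add_nonneg_eq_0_iff split: if_splits)
  have "c < 1"
  proof (rule ccontr)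
    assume "\<not> c < 1"
    then have "1 * (1 + real k) \<le> c * (1 + real k)" by (intro mult_right_mono) auto
    also note le
    finally show False by simp
  qed
  moreover have "c \<ge> 1" using count_less_if_unbalanced[OF unb] by (simp add: c_def)
  ultimately show False by simp
qed

text \<open>The estimate must also hold where the quotient is left out: there the trace is bounded
  by \<open>k * N h = 0\<close>, so the defect is 0.\<close>

lemma defect_le_if_quotient:
  assumes "\<epsilon> \<ge> 0"
    and "(of_nat (k * N h) :: complex) \<noteq> 0 \<Longrightarrow> cmod (mat_trace (A\<pi> ^\<^sub>m h) / of_nat (k * N h) - 1) < \<epsilon>"
  shows "defect h \<le> \<epsilon> * real (k * N h)"
proof (cases "k * N h = 0")
  case True
  then have "real k * real (N h) = 0" by (metis of_nat_0 of_nat_mult)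
  then have "cmod (mat_trace (A\<pi> ^\<^sub>m h)) \<le> 0" using norm_trace_A\<pi>_le[of h] by linarith
  then have "mat_trace (A\<pi> ^\<^sub>m h) = 0" by simp
  then show ?thesis unfolding defect_def True by simp
next
  case False
  define g where "g = (of_nat (k * N h) :: complex)"
  have g: "g \<noteq> 0" "cmod g = real (k * N h)" "Re g = real (k * N h)"
    using False by (auto simp: g_def simp del: of_nat_mult)
  have "defect h = Re (g - mat_trace (A\<pi> ^\<^sub>m h))" by (simp add: defect_def g)
  also have "\<dots> \<le> cmod (mat_trace (A\<pi> ^\<^sub>m h) - g)"
    by (metis complex_Re_le_cmod norm_minus_commute)
  also have "mat_trace (A\<pi> ^\<^sub>m h) - g = (mat_trace (A\<pi> ^\<^sub>m h) / g - 1) * g"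
    using g by (simp add: field_simps)
  also have "cmod \<dots> \<le> \<epsilon> * real (k * N h)"
    unfolding norm_mult g(2) using assms(2) g(1) unfolding g_def[symmetric]
    by (intro mult_right_mono) auto
  finally show ?thesis .
qed

lemma balanced_iff_quotient:
  "balanced G \<Gamma> \<Psi> \<longleftrightarrow>
    (\<not> bipartite \<Gamma> \<longrightarrow>
      quotient_tendsto_one (\<lambda>h. mat_trace (A\<pi> ^\<^sub>m h))
        (\<lambda>h. mat_trace (abs_rep_adjacency_mat G k \<pi> \<Gamma> vs ^\<^sub>m h))) \<and>
    (bipartite \<Gamma> \<longrightarrow>
      quotient_tendsto_one (\<lambda>h. mat_trace (A\<pi> ^\<^sub>m (2 * h)))
        (\<lambda>h. mat_trace (abs_rep_adjacency_mat G k \<pi> \<Gamma> vs ^\<^sub>m (2 * h))))"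
  (is "_ \<longleftrightarrow> ?Q")
proof
  assume "balanced G \<Gamma> \<Psi>"
  then show ?Q
    by (simp add: quotient_tendsto_one_def trace_A\<pi>_eq_if_balanced trace_abs_pow del: of_nat_mult)
next
  assume Q: ?Q
  show "balanced G \<Gamma> \<Psi>"
  proof (rule balanced_if_defect_small)
    fix \<epsilon> :: real assume \<epsilon>: "\<epsilon> > 0"
    show "\<exists>M. \<forall>h\<ge>M. defect h \<le> \<epsilon> * real (k * N h)"
    proof (cases "bipartite \<Gamma>")
      case False
      then obtain M where "\<forall>h\<ge>M. (of_nat (k * N h) :: complex) \<noteq> 0 \<longrightarrow>
        cmod (mat_trace (A\<pi> ^\<^sub>m h) / of_nat (k * N h) - 1) < \<epsilon>"
        using Q \<epsilon> unfolding quotient_tendsto_one_def trace_abs_pow by blast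
      then show ?thesis using defect_le_if_quotient[of \<epsilon>] \<epsilon> by (meson less_imp_le)
    next
      case True
      then obtain M where M: "\<forall>h\<ge>M. (of_nat (k * N (2 * h)) :: complex) \<noteq> 0 \<longrightarrow>
        cmod (mat_trace (A\<pi> ^\<^sub>m (2 * h)) / of_nat (k * N (2 * h)) - 1) < \<epsilon>"
        using Q \<epsilon> unfolding quotient_tendsto_one_def trace_abs_pow by blast
      \<comment> \<open>\<open>M\<close> bounds half the exponent, so the threshold doubles; an odd
        \<open>h\<close> has no closed walks and hence a zero denominator.\<close>
      have "defect h \<le> \<epsilon> * real (k * N h)" if h: "h \<ge> 2 * M" for h
      proof (rule defect_le_if_quotient)
        show "\<epsilon> \<ge> 0" using \<epsilon> by simp
        assume nz: "(of_nat (k * N h) :: complex) \<noteq> 0"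
        have "even h"
        proof (rule ccontr)
          assume "odd h"
          then show False using nz bipartite_closed_walks_odd[OF graph True] by simp
        qed
        then obtain l where "h = 2 * l" by (rule evenE)
        then show "cmod (mat_trace (A\<pi> ^\<^sub>m h) / of_nat (k * N h) - 1) < \<epsilon>"
          using M h nz by simp
      qed
      then show ?thesis by blast
    qed
  qed
qed

end

theorem theorem3:
  fixes G :: "('g, 'm) monoid_scheme"
    and k :: nat
    and \<pi> :: "'g \<Rightarrow> complex mat"
    and \<Gamma> :: "'v pair_pre_digraph"
    and \<Psi> :: "'v \<times> 'v \<Rightarrow> 'g"
    and vs :: "'v list"
  defines "A \<equiv> adjacency_mat \<Gamma> vs"
    and "A\<pi> \<equiv> rep_adjacency_mat k \<pi> \<Gamma> \<Psi> vs"
    and "absA\<pi> \<equiv> abs_rep_adjacency_mat G k \<pi> \<Gamma> vs"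
  assumes "group G"
    and "unitary_representation G k \<pi>"
    and "faithful_representation G k \<pi>"
    and "pair_graph \<Gamma>"
    and "gain_function G \<Gamma> \<Psi>"
    and "distinct vs" and "set vs = pverts \<Gamma>"
  shows "(balanced G \<Gamma> \<Psi> \<longleftrightarrow> mspectrum A\<pi> = repeat_mset k (mspectrum A)) \<and>
    (finite (carrier G) \<and> Digraph_Component.connected (with_proj \<Gamma>) \<longrightarrow>
      (balanced G \<Gamma> \<Psi> \<longleftrightarrow> count (mspectrum A\<pi>) (complex_of_real (spectral_radius A)) = k) \<and>
      (balanced G \<Gamma> \<Psi> \<longleftrightarrow>
        (\<not> bipartite \<Gamma> \<longrightarrow>
          quotient_tendsto_one (\<lambda>h. mat_trace (A\<pi> ^\<^sub>m h)) (\<lambda>h. mat_trace (absA\<pi> ^\<^sub>m h))) \<and>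
        (bipartite \<Gamma> \<longrightarrow>
          quotient_tendsto_one (\<lambda>h. mat_trace (A\<pi> ^\<^sub>m (2 * h)))
            (\<lambda>h. mat_trace (absA\<pi> ^\<^sub>m (2 * h))))))"
proof -
  interpret represented_gain_graph G k \<pi> \<Gamma> \<Psi> vs
    using assms(8) by (intro represented_gain_graph.intro assms(4-)) (auto simp: gain_function_def)
  show ?thesis
    unfolding A_def A\<pi>_def absA\<pi>_def
  proof (intro conjI impI)
    show "balanced G \<Gamma> \<Psi> \<longleftrightarrow>
      mspectrum (rep_adjacency_mat k \<pi> \<Gamma> \<Psi> vs) = repeat_mset k (mspectrum (adjacency_mat \<Gamma> vs))"
      by (rule balanced_iff_mspectrum) fact
  next
    assume "finite (carrier G) \<and> Digraph_Component.connected (with_proj \<Gamma>)"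
    then interpret finite_connected_gain_graph G k \<pi> \<Gamma> \<Psi> vs
      by (intro finite_connected_gain_graph.intro finite_connected_gain_graph_axioms.intro
          represented_gain_graph_axioms assms(4-)) auto
    show "balanced G \<Gamma> \<Psi> \<longleftrightarrow> count (mspectrum (rep_adjacency_mat k \<pi> \<Gamma> \<Psi> vs))
      (complex_of_real (spectral_radius (adjacency_mat \<Gamma> vs))) = k"
      by (rule balanced_iff_count)
    show "balanced G \<Gamma> \<Psi> \<longleftrightarrow>
      (\<not> bipartite \<Gamma> \<longrightarrow>
        quotient_tendsto_one (\<lambda>h. mat_trace (rep_adjacency_mat k \<pi> \<Gamma> \<Psi> vs ^\<^sub>m h))
          (\<lambda>h. mat_trace (abs_rep_adjacency_mat G k \<pi> \<Gamma> vs ^\<^sub>m h))) \<and>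
      (bipartite \<Gamma> \<longrightarrow>
        quotient_tendsto_one (\<lambda>h. mat_trace (rep_adjacency_mat k \<pi> \<Gamma> \<Psi> vs ^\<^sub>m (2 * h)))
          (\<lambda>h. mat_trace (abs_rep_adjacency_mat G k \<pi> \<Gamma> vs ^\<^sub>m (2 * h))))"
      by (rule balanced_iff_quotient)
  qed
qed

end
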